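(* Let $\mathbb{F}$ be a field in which every quadratic and every cubic polynomial has a root. The number of nontrivial (that is, one-dimensional) two-sided ideals of the algebras of the context (parameters in $\mathbb{F}$) is as follows. (I) $\mathrm{Char}(\mathbb{F})=2$: - $A_{1,2}(\alpha_1,\alpha_2,\alpha_4,\beta_1)$: no ideal if $\alpha_4\neq\alpha_1$ or $\beta_1\neq\alpha_2$; one ideal if $\alpha_4=\alpha_1$ and $\beta_1=\alpha_2$. - $A_{2,2}(\alpha_1,\beta_1,\beta_2)$: no ideal if ($\beta_2=1-\alpha_1$ and $1-\alpha_1+\beta_1^2\neq0$) or $\beta_2\neq1-\alpha_1$; one ideal if $\beta_2=1-\alpha_1$ and $1-\alpha_1+\beta_1^2=0$. - $A_{3,2}(\alpha_1,\beta_2)$: no ideal if $\alpha_1\neq1$ or $\beta_2\neq0$; two ideals if $\alpha_1=1$, $\beta_2=0$. - $A_{4,2}(\alpha_1,\beta_2)$: one ideal if ($\alpha_1\neq1$ and $\beta_2=1-\alpha_1$) or $\beta_2\neq1-\alpha_1$; two ideals if $\alpha_1=1$, $\beta_2=0$. - $A_{5,2}(\alpha_1)$, $A_{8,2}(\alpha_1)$, $A_{9,2}$, $A_{10,2}$, $A_{12,2}$: one ideal, for all values of the parameters. - $A_{6,2}(\alpha_1,\beta_1)$, $A_{7,2}(\alpha_1)$, $A_{11,2}$: no ideal, for all values of the parameters. (II) $\mathrm{Char}(\mathbb{F})=3$: - $A_{1,3}(\alpha_1,\alpha_2,\alpha_4,\beta_1)$: no ideal if $\alpha_4\neq-\alpha_1-2\alpha_2$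 or $\beta_1\neq2\alpha_1+\alpha_2$; one ideal if $\alpha_4=-\alpha_1-2\alpha_2$ and $\beta_1=2\alpha_1+\alpha_2$. - $A_{2,3}(\alpha_1,\beta_1,\beta_2)$: no ideal if one of the following holds: ($\alpha_1=1$, $\beta_1\neq0$, $\beta_2=0$); ($\alpha_1\neq\frac12,1$, $\beta_1^2+\alpha_1-1\neq0$, $\beta_2=1-\alpha_1$); ($\alpha_1=\beta_2=\frac12$, $\beta_1\neq0$); $\beta_2\neq1-\alpha_1$. One ideal if ($\alpha_1=1$, $\beta_1=\beta_2=0$) or ($\alpha_1\neq\frac12,1$, $\beta_2=1-\alpha_1$, $\beta_1^2+\alpha_1-1=0$). Two ideals if $\alpha_1=\beta_2=\frac12$, $\beta_1=0$. - $A_{3,3}(\beta_1,\beta_2)$: no ideal if ($\beta_1\neq-1$ and $\beta_2=1$) or $\beta_2\neq1$; one ideal if $\beta_1=-1$, $\beta_2=1$. - $A_{4,3}(\alpha_1,\beta_2)$: one ideal if ($\alpha_1\neq1$ and $\beta_2=1-\alpha_1$) or $\beta_2\neq1-\alpha_1$; two ideals if $\alpha_1=1$, $\beta_2=0$. - $A_{5,3}(\alpha_1)$, $A_{8,3}(\alpha_1)$, $A_{10,3}$, $A_{11,3}$, $A_{12,3}$: one ideal, for all values of the parameters. - $A_{6,3}(\alpha_1,\beta_1)$, $A_{7,3}(\beta_1)$, $A_{9,3}$: no ideal, for all values of the parameters. In particular, in each of the two characteristics the algebras listed with no ideal give the classification, up to isomorphism, of all simple two-dimensional algebras over $\mathb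b{F}$.
   Context: An algebra is a vector space with a bilinear product (not necessarily associative, commutative or unital); it is nontrivial if its product is not identically zero, and only nontrivial algebras are considered. An algebra is called simple if it has no nontrivial two-sided ideal; a nontrivial two-sided ideal of a two-dimensional algebra $\mathbb{A}$ is a one-dimensional subspace $\mathbb{F}\mathbf u$ with $\mathbf v\mathbf u,\mathbf u\mathbf v\in\mathbb{F}\mathbf u$ for all $\mathbf v\in\mathbb{A}$. A two-dimensional algebra with basis $e_1,e_2$ is identified with its matrix of structure constants (MSC) $A=\begin{pmatrix}\alpha_1&\alpha_2&\alpha_3&\alpha_4\\ \beta_1&\beta_2&\beta_3&\beta_4\end{pmatrix}$, meaning $e_1e_1=\alpha_1e_1+\beta_1e_2$, $e_1e_2=\alpha_2e_1+\beta_2e_2$, $e_2e_1=\alpha_3e_1+\beta_3e_2$, $e_2e_2=\alpha_4e_1+\beta_4e_2$. It is known from earlier work that in each of the two characteristics every nontrivial two-dimensional algebra over $\mathbb{F}$ is isomorphic to only one of the following, where in characteristic 3 one identifies $A_{2,3}(\alpha_1,\beta_1,\beta_2)\simeq A_{2,3}(\alpha_1,-\beta_1,\beta_2)$ and $A_{6,3}(\alpha_1,\beta_1)\simeq A_{6,3}(\alpha_1,-\beta_1)$. Families for $\mathrm{Char}(\mathbb{F})=2$: $A_{1,2}(\alpha_1,\alpha_2,\alpha_4,\beta_1)=\begin{pmatrix}\alpha_1&\alpha_2&\alpha_2+1&\alpha_4\\ \beta_1&-\alpha_1&-\alpha_1+1&-\alpha_2\end{pmatrix}$, $A_{2,2}(\alpha_1,\beta_1,\beta_2)=\begin{pmatrix}\alpha_1&0&0&1\\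 \beta_1&\beta_2&1-\alpha_1&0\end{pmatrix}$, $A_{3,2}(\alpha_1,\beta_2)=\begin{pmatrix}\alpha_1&1&1&0\\ 0&\beta_2&1-\alpha_1&1\end{pmatrix}$, $A_{4,2}(\alpha_1,\beta_2)=\begin{pmatrix}\alpha_1&0&0&0\\ 0&\beta_2&1-\alpha_1&0\end{pmatrix}$, $A_{5,2}(\alpha_1)=\begin{pmatrix}\alpha_1&0&0&0\\ 1&1&1-\alpha_1&0\end{pmatrix}$, $A_{6,2}(\alpha_1,\beta_1)=\begin{pmatrix}\alpha_1&0&0&1\\ \beta_1&1-\alpha_1&-\alpha_1&0\end{pmatrix}$, $A_{7,2}(\alpha_1)=\begin{pmatrix}\alpha_1&1&1&0\\ 0&1-\alpha_1&-\alpha_1&-1\end{pmatrix}$, $A_{8,2}(\alpha_1)=\begin{pmatrix}\alpha_1&0&0&0\\ 0&1-\alpha_1&-\alpha_1&0\end{pmatrix}$, $A_{9,2}=\begin{pmatrix}1&0&0&0\\ 1&0&1&0\end{pmatrix}$, $A_{10,2}=\begin{pmatrix}0&1&1&0\\ 0&0&0&-1\end{pmatrix}$, $A_{11,2}=\begin{pmatrix}1&1&1&0\\ 0&-1&-1&-1\end{pmatrix}$, $A_{12,2}=\begin{pmatrix}0&0&0&0\\ 1&0&0&0\end{pmatrix}$. Families for $\mathrm{Char}(\mathbb{F})=3$: $A_{1,3}(\alpha_1,\alpha_2,\alpha_4,\beta_1)=\begin{pmatrix}\alpha_1&\alpha_2&\alpha_2+1&\alpha_4\\ \beta_1&-\alpha_1&-\alpha_1+1&-\alpha_2\end{pmatrix}$,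 $A_{2,3}(\alpha_1,\beta_1,\beta_2)=\begin{pmatrix}\alpha_1&0&0&1\\ \beta_1&\beta_2&1-\alpha_1&0\end{pmatrix}$, $A_{3,3}(\beta_1,\beta_2)=\begin{pmatrix}0&1&1&0\\ \beta_1&\beta_2&1&-1\end{pmatrix}$, $A_{4,3}(\alpha_1,\beta_2)=\begin{pmatrix}\alpha_1&0&0&0\\ 0&\beta_2&1-\alpha_1&0\end{pmatrix}$, $A_{5,3}(\alpha_1)=\begin{pmatrix}\alpha_1&0&0&0\\ 1&-1-\alpha_1&1-\alpha_1&0\end{pmatrix}$, $A_{6,3}(\alpha_1,\beta_1)=\begin{pmatrix}\alpha_1&0&0&1\\ \beta_1&1-\alpha_1&-\alpha_1&0\end{pmatrix}$, $A_{7,3}(\beta_1)=\begin{pmatrix}0&1&1&0\\ \beta_1&1&0&-1\end{pmatrix}$, $A_{8,3}(\alpha_1)=\begin{pmatrix}\alpha_1&0&0&0\\ 0&1-\alpha_1&-\alpha_1&0\end{pmatrix}$, $A_{9,3}=\begin{pmatrix}0&1&1&0\\ 1&0&0&-1\end{pmatrix}$, $A_{10,3}=\begin{pmatrix}0&1&1&0\\ 0&0&0&-1\end{pmatrix}$, $A_{11,3}=\begin{pmatrix}1&0&0&0\\ 1&-1&-1&0\end{pmatrix}$, $A_{12,3}=\begin{pmatrix}0&0&0&0\\ 1&0&0&0\end{pmatrix}$.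
   Formalization: For A_{2,3} with α1≠1/2,1 and β2=1−α1, the printed β1²+α1−1 is replaced by β1²+(α1−1)(2α1−1)² in the no-ideal and one-ideal conditions and in the list of simple algebras; as printed it fails, e.g. α1²=−1, β1²=1−α1 has no ideal. *)

theory Defs
  imports "HOL-Analysis.Analysis" "HOL-Computational_Algebra.Computational_Algebra"
begin

section \<open>Two-dimensional algebras\<close>

text \<open>An algebra is a vector space, given by its scalar multiplication \<open>scl\<close>, together with a
  bilinear product \<open>mul\<close>; no associativity, commutativity or unit is required.\<close>

definition two_dim_algebra ::
  "('a::field \<Rightarrow> 'v::ab_group_add \<Rightarrow> 'v) \<Rightarrow> ('v \<Rightarrow> 'v \<Rightarrow> 'v) \<Rightarrow> bool" where
  "two_dim_algebra scl mul \<longleftrightarrow>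
     vector_space scl \<and> vector_space.dim scl UNIV = 2 \<and>
     (\<forall>x. Vector_Spaces.linear scl scl (\<lambda>y. mul x y)) \<and>
     (\<forall>y. Vector_Spaces.linear scl scl (\<lambda>x. mul x y))"

definition nontrivial_ideals ::
  "('a::field \<Rightarrow> 'v::ab_group_add \<Rightarrow> 'v) \<Rightarrow> ('v \<Rightarrow> 'v \<Rightarrow> 'v) \<Rightarrow> 'v set set" where
  "nontrivial_ideals scl mul =
     {I. \<exists>u. u \<noteq> 0 \<and> I = module.span scl {u} \<and> (\<forall>v. mul v u \<in> I \<and> mul u v \<in> I)}"

definition simple_two_dim_algebra ::
  "('a::field \<Rightarrow> 'v::ab_group_add \<Rightarrow> 'v) \<Rightarrow> ('v \<Rightarrow> 'v \<Rightarrow> 'v) \<Rightarrow> bool" where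
  "simple_two_dim_algebra scl mul \<longleftrightarrow>
     two_dim_algebra scl mul \<and> (\<exists>x y. mul x y \<noteq> 0) \<and> nontrivial_ideals scl mul = {}"

definition algebra_isomorphic ::
  "('a::field \<Rightarrow> 'v::ab_group_add \<Rightarrow> 'v) \<Rightarrow> ('v \<Rightarrow> 'v \<Rightarrow> 'v) \<Rightarrow>
   ('a \<Rightarrow> 'w::ab_group_add \<Rightarrow> 'w) \<Rightarrow> ('w \<Rightarrow> 'w \<Rightarrow> 'w) \<Rightarrow> bool" where
  "algebra_isomorphic scl1 mul1 scl2 mul2 \<longleftrightarrow>
     (\<exists>f. Vector_Spaces.linear scl1 scl2 f \<and> bij f \<and>
          (\<forall>x y. f (mul1 x y) = mul2 (f x) (f y)))"


section \<open>Matrices of structure constants\<close>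

definition msc :: "'a list \<Rightarrow> 'a list \<Rightarrow> 'a::field^4^2" where
  "msc as bs = vector [vector as, vector bs]"

definition msc_mult :: "'a::field^4^2 \<Rightarrow> 'a^2 \<Rightarrow> 'a^2 \<Rightarrow> 'a^2" where
  "msc_mult A x y = A *v vector [x$1 * y$1, x$1 * y$2, x$2 * y$1, x$2 * y$2]"

lemma msc_mult_nth:
  "msc_mult (msc [a1, a2, a3, a4] [b1, b2, b3, b4]) x y $ 1 =
     a1 * (x$1 * y$1) + a2 * (x$1 * y$2) + a3 * (x$2 * y$1) + a4 * (x$2 * y$2)"
  "msc_mult (msc [a1, a2, a3, a4] [b1, b2, b3, b4]) x y $ 2 =
     b1 * (x$1 * y$1) + b2 * (x$1 * y$2) + b3 * (x$2 * y$1) + b4 * (x$2 * y$2)"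
  by (simp_all add: msc_mult_def msc_def matrix_vector_mult_def sum_4 vector_def)

lemma msc_mult_basis:
  fixes a1 a2 a3 a4 b1 b2 b3 b4 :: "'a::field"
  defines "A \<equiv> msc [a1, a2, a3, a4] [b1, b2, b3, b4]"
    and "e1 \<equiv> axis 1 1 :: 'a^2" and "e2 \<equiv> axis 2 1 :: 'a^2"
  shows "msc_mult A e1 e1 = a1 *s e1 + b1 *s e2"
    and "msc_mult A e1 e2 = a2 *s e1 + b2 *s e2"
    and "msc_mult A e2 e1 = a3 *s e1 + b3 *s e2"
    and "msc_mult A e2 e2 = a4 *s e1 + b4 *s e2"
  by (simp_all add: assms vec_eq_iff forall_2 msc_mult_nth axis_def)

abbreviation msc_ideals :: "'a::field^4^2 \<Rightarrow> ('a^2) set set" where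
  "msc_ideals A \<equiv> nontrivial_ideals (*s) (msc_mult A)"

text \<open>The finiteness conjunct matters: \<^const>\<open>card\<close> is \<open>0\<close> on infinite sets.\<close>

definition has_ideals :: "'a::field^4^2 \<Rightarrow> nat \<Rightarrow> bool" where
  "has_ideals A n \<longleftrightarrow> finite (msc_ideals A) \<and> card (msc_ideals A) = n"

abbreviation msc_simple :: "'a::field^4^2 \<Rightarrow> bool" where
  "msc_simple A \<equiv> simple_two_dim_algebra (*s) (msc_mult A)"

abbreviation msc_isomorphic :: "'a::field^4^2 \<Rightarrow> 'a^4^2 \<Rightarrow> bool" where
  "msc_isomorphic A B \<equiv> algebra_isomorphic (*s) (msc_mult A) (*s) (msc_mult B)"


section \<open>The canonical families\<close>

text \<open>The families are syntactic, so that ``isomorphic to only one'' also separates different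
  families and different parameters.\<close>

subsection \<open>Characteristic 2\<close>

datatype 'a family2 =
    A1_2 'a 'a 'a 'a | A2_2 'a 'a 'a | A3_2 'a 'a | A4_2 'a 'a | A5_2 'a | A6_2 'a 'a
  | A7_2 'a | A8_2 'a | A9_2 | A10_2 | A11_2 | A12_2

fun msc2 :: "'a::field family2 \<Rightarrow> 'a^4^2" where
  "msc2 (A1_2 \<alpha>\<^sub>1 \<alpha>\<^sub>2 \<alpha>\<^sub>4 \<beta>\<^sub>1) =
     msc [\<alpha>\<^sub>1, \<alpha>\<^sub>2, \<alpha>\<^sub>2 + 1, \<alpha>\<^sub>4]
         [\<beta>\<^sub>1, - \<alpha>\<^sub>1, - \<alpha>\<^sub>1 + 1, - \<alpha>\<^sub>2]"
| "msc2 (A2_2 \<alpha>\<^sub>1 \<beta>\<^sub>1 \<beta>\<^sub>2) =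
     msc [\<alpha>\<^sub>1, 0, 0, 1]
         [\<beta>\<^sub>1, \<beta>\<^sub>2, 1 - \<alpha>\<^sub>1, 0]"
| "msc2 (A3_2 \<alpha>\<^sub>1 \<beta>\<^sub>2) =
     msc [\<alpha>\<^sub>1, 1, 1, 0]
         [0, \<beta>\<^sub>2, 1 - \<alpha>\<^sub>1, 1]"
| "msc2 (A4_2 \<alpha>\<^sub>1 \<beta>\<^sub>2) =
     msc [\<alpha>\<^sub>1, 0, 0, 0]
         [0, \<beta>\<^sub>2, 1 - \<alpha>\<^sub>1, 0]"
| "msc2 (A5_2 \<alpha>\<^sub>1) =
     msc [\<alpha>\<^sub>1, 0, 0, 0]
         [1, 1, 1 - \<alpha>\<^sub>1, 0]"
| "msc2 (A6_2 \<alpha>\<^sub>1 \<beta>\<^sub>1) =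
     msc [\<alpha>\<^sub>1, 0, 0, 1]
         [\<beta>\<^sub>1, 1 - \<alpha>\<^sub>1, - \<alpha>\<^sub>1, 0]"
| "msc2 (A7_2 \<alpha>\<^sub>1) =
     msc [\<alpha>\<^sub>1, 1, 1, 0]
         [0, 1 - \<alpha>\<^sub>1, - \<alpha>\<^sub>1, -1]"
| "msc2 (A8_2 \<alpha>\<^sub>1) =
     msc [\<alpha>\<^sub>1, 0, 0, 0]
         [0, 1 - \<alpha>\<^sub>1, - \<alpha>\<^sub>1, 0]"
| "msc2 A9_2 =
     msc [1, 0, 0, 0]
         [1, 0, 1, 0]"
| "msc2 A10_2 =
     msc [0, 1, 1, 0]
         [0, 0, 0, -1]"
| "msc2 A11_2 =
     msc [1, 1, 1, 0]
         [0, -1, -1, -1]"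
| "msc2 A12_2 =
     msc [0, 0, 0, 0]
         [1, 0, 0, 0]"

definition no_ideal_list2 :: "'a::field family2 set" where
  "no_ideal_list2 =
     {A1_2 \<alpha>\<^sub>1 \<alpha>\<^sub>2 \<alpha>\<^sub>4 \<beta>\<^sub>1 | \<alpha>\<^sub>1 \<alpha>\<^sub>2 \<alpha>\<^sub>4 \<beta>\<^sub>1. \<alpha>\<^sub>4 \<noteq> \<alpha>\<^sub>1 \<or> \<beta>\<^sub>1 \<noteq> \<alpha>\<^sub>2} \<union>
     {A2_2 \<alpha>\<^sub>1 \<beta>\<^sub>1 \<beta>\<^sub>2 | \<alpha>\<^sub>1 \<beta>\<^sub>1 \<beta>\<^sub>2.
        (\<beta>\<^sub>2 = 1 - \<alpha>\<^sub>1 \<and> 1 - \<alpha>\<^sub>1 + \<beta>\<^sub>1^2 \<noteq> 0) \<or> \<beta>\<^sub>2 \<noteq> 1 - \<alpha>\<^sub>1} \<union>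
     {A3_2 \<alpha>\<^sub>1 \<beta>\<^sub>2 | \<alpha>\<^sub>1 \<beta>\<^sub>2. \<alpha>\<^sub>1 \<noteq> 1 \<or> \<beta>\<^sub>2 \<noteq> 0} \<union>
     {A6_2 \<alpha>\<^sub>1 \<beta>\<^sub>1 | \<alpha>\<^sub>1 \<beta>\<^sub>1. True} \<union>
     {A7_2 \<alpha>\<^sub>1 | \<alpha>\<^sub>1. True} \<union>
     {A11_2}"


subsection \<open>Characteristic 3\<close>

datatype 'a family3 =
    A1_3 'a 'a 'a 'a | A2_3 'a 'a 'a | A3_3 'a 'a | A4_3 'a 'a | A5_3 'a | A6_3 'a 'a
  | A7_3 'a | A8_3 'a | A9_3 | A10_3 | A11_3 | A12_3

fun msc3 :: "'a::field family3 \<Rightarrow> 'a^4^2" where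
  "msc3 (A1_3 \<alpha>\<^sub>1 \<alpha>\<^sub>2 \<alpha>\<^sub>4 \<beta>\<^sub>1) =
     msc [\<alpha>\<^sub>1, \<alpha>\<^sub>2, \<alpha>\<^sub>2 + 1, \<alpha>\<^sub>4]
         [\<beta>\<^sub>1, - \<alpha>\<^sub>1, - \<alpha>\<^sub>1 + 1, - \<alpha>\<^sub>2]"
| "msc3 (A2_3 \<alpha>\<^sub>1 \<beta>\<^sub>1 \<beta>\<^sub>2) =
     msc [\<alpha>\<^sub>1, 0, 0, 1]
         [\<beta>\<^sub>1, \<beta>\<^sub>2, 1 - \<alpha>\<^sub>1, 0]"
| "msc3 (A3_3 \<beta>\<^sub>1 \<beta>\<^sub>2) =
     msc [0, 1, 1, 0]
         [\<beta>\<^sub>1, \<beta>\<^sub>2, 1, -1]"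
| "msc3 (A4_3 \<alpha>\<^sub>1 \<beta>\<^sub>2) =
     msc [\<alpha>\<^sub>1, 0, 0, 0]
         [0, \<beta>\<^sub>2, 1 - \<alpha>\<^sub>1, 0]"
| "msc3 (A5_3 \<alpha>\<^sub>1) =
     msc [\<alpha>\<^sub>1, 0, 0, 0]
         [1, -1 - \<alpha>\<^sub>1, 1 - \<alpha>\<^sub>1, 0]"
| "msc3 (A6_3 \<alpha>\<^sub>1 \<beta>\<^sub>1) =
     msc [\<alpha>\<^sub>1, 0, 0, 1]
         [\<beta>\<^sub>1, 1 - \<alpha>\<^sub>1, - \<alpha>\<^sub>1, 0]"
| "msc3 (A7_3 \<beta>\<^sub>1) =
     msc [0, 1, 1, 0]
         [\<beta>\<^sub>1, 1, 0, -1]"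
| "msc3 (A8_3 \<alpha>\<^sub>1) =
     msc [\<alpha>\<^sub>1, 0, 0, 0]
         [0, 1 - \<alpha>\<^sub>1, - \<alpha>\<^sub>1, 0]"
| "msc3 A9_3 =
     msc [0, 1, 1, 0]
         [1, 0, 0, -1]"
| "msc3 A10_3 =
     msc [0, 1, 1, 0]
         [0, 0, 0, -1]"
| "msc3 A11_3 =
     msc [1, 0, 0, 0]
         [1, -1, -1, 0]"
| "msc3 A12_3 =
     msc [0, 0, 0, 0]
         [1, 0, 0, 0]"

text \<open>The line spanned by \<open>e\<^sub>1 + t e\<^sub>2\<close> is an ideal of \<open>A2_3 \<alpha>\<^sub>1 \<beta>\<^sub>1 \<beta>\<^sub>2\<close> iff
  \<open>\<beta>\<^sub>2 = 1 - \<alpha>\<^sub>1 = t\<^sup>2\<close> and \<open>\<beta>\<^sub>1 = t (2 \<alpha>\<^sub>1 - 1)\<close>. Eliminating \<open>t\<close> gives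
  \<open>\<beta>\<^sub>1\<^sup>2 + (\<alpha>\<^sub>1 - 1) (2 \<alpha>\<^sub>1 - 1)\<^sup>2 = 0\<close>. The source prints \<open>\<beta>\<^sub>1\<^sup>2 + \<alpha>\<^sub>1 - 1\<close> here, omitting
  the factor \<open>(2 \<alpha>\<^sub>1 - 1)\<^sup>2\<close>; that factor is \<open>1\<close> in characteristic 2 but not in
  characteristic 3, where the printed condition is wrong: if \<open>\<alpha>\<^sub>1\<^sup>2 = -1\<close> and
  \<open>\<beta>\<^sub>1\<^sup>2 = 1 - \<alpha>\<^sub>1\<close>, it predicts one ideal of \<open>A2_3 \<alpha>\<^sub>1 \<beta>\<^sub>1 (1 - \<alpha>\<^sub>1)\<close>, but there is none
  (as proved next).\<close>

lemma printed_A2_3_condition_fails: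
  fixes \<alpha>\<^sub>1 \<beta>\<^sub>1 :: "'a::field"
  assumes char: "CHAR('a) = 3" and \<alpha>: "\<alpha>\<^sub>1^2 = -1" and \<beta>: "\<beta>\<^sub>1^2 + \<alpha>\<^sub>1 - 1 = 0"
  shows "\<alpha>\<^sub>1 \<noteq> 1/2" and "\<alpha>\<^sub>1 \<noteq> 1" and "msc_ideals (msc3 (A2_3 \<alpha>\<^sub>1 \<beta>\<^sub>1 (1 - \<alpha>\<^sub>1))) = {}"
proof -
  have three: "(3::'a) = 0"
    using of_nat_CHAR[where 'a='a] char by simp
  have two: "(2::'a) \<noteq> 0"
  proof
    assume "(2::'a) = 0"
    then have "(3::'a) - 2 = 0" using three by simp
    then show False by simp
  qed
  show n1: "\<alpha>\<^sub>1 \<noteq> 1"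
  proof
    assume "\<alpha>\<^sub>1 = 1"
    then have "(2::'a) = 0" using \<alpha> by (simp add: eq_neg_iff_add_eq_0)
    then show False using two by simp
  qed
  have "(2::'a) + 1 = 0" using three by simp
  then have "1 = (-1) * (2::'a)" by (simp add: eq_neg_iff_add_eq_0 add.commute)
  then have half: "1/2 = (-1::'a)" using two by (metis nonzero_divide_eq_eq)
  have n2: "\<alpha>\<^sub>1 \<noteq> -1"
  proof
    assume "\<alpha>\<^sub>1 = -1"
    then have "1 = (-1::'a)" using \<alpha> by simp
    then have "(2::'a) = 0" by (simp add: eq_neg_iff_add_eq_0)
    then show False using two by simp
  qed
  then show "\<alpha>\<^sub>1 \<noteq> 1/2" by (simp only: half not_False_eq_True simp_thms)
  show "msc_ideals (msc3 (A2_3 \<alpha>\<^sub>1 \<beta>\<^sub>1 (1 - \<alpha>\<^sub>1))) = {}"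
  proof (rule ccontr)
    let ?m = "msc_mult (msc3 (A2_3 \<alpha>\<^sub>1 \<beta>\<^sub>1 (1 - \<alpha>\<^sub>1)))"
    assume "\<not> ?thesis"
    then obtain u where u: "u \<noteq> 0" and I: "\<And>v. ?m v u \<in> vec.span {u}"
      unfolding nontrivial_ideals_def by blast
    obtain k where k: "?m (axis 2 1) u = k *s u" using I[of "axis 2 1"] by (auto simp: vec.span_singleton)
    obtain l where l: "?m (axis 1 1) u = l *s u" using I[of "axis 1 1"] by (auto simp: vec.span_singleton)
    have 1: "u$2 = k * u$1" "(1 - \<alpha>\<^sub>1) * u$1 = k * u$2"
      "\<alpha>\<^sub>1 * u$1 = l * u$1" "\<beta>\<^sub>1 * u$1 + (1 - \<alpha>\<^sub>1) * u$2 = l * u$2"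
      using k l by (simp_all add: vec_eq_iff forall_2 msc_mult_nth axis_def)
    have p: "u$1 \<noteq> 0" using u 1(1) by (auto simp: vec_eq_iff forall_2)
    have 2: "1 - \<alpha>\<^sub>1 = k^2" using 1(1,2) p by (simp add: power2_eq_square)
    have l': "l = \<alpha>\<^sub>1" using 1(3) p by simp
    have "u$1 * (\<beta>\<^sub>1 - k * (2 * \<alpha>\<^sub>1 - 1)) = 0" using 1(4) unfolding l' 1(1) by (simp add: algebra_simps)
    then have 3: "\<beta>\<^sub>1 = k * (2 * \<alpha>\<^sub>1 - 1)" using p by simp
    have 4: "(2 * \<alpha>\<^sub>1 - 1)^2 = - \<alpha>\<^sub>1" proof -
      have "(2 * \<alpha>\<^sub>1 - 1)^2 = 4 * \<alpha>\<^sub>1^2 - 4 * \<alpha>\<^sub>1 + 1" by (simp add: power2_eq_square algebra_simps)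
      also have "\<dots> = - 3 - 3 * \<alpha>\<^sub>1 - \<alpha>\<^sub>1" unfolding \<alpha> by (simp add: algebra_simps)
      finally show ?thesis by (simp add: three)
    qed
    have "\<beta>\<^sub>1^2 = (1 - \<alpha>\<^sub>1) * - \<alpha>\<^sub>1" unfolding 3 power_mult_distrib 4 2[symmetric] ..
    moreover have "\<beta>\<^sub>1^2 = 1 - \<alpha>\<^sub>1" using \<beta> by (simp add: algebra_simps)
    ultimately have "(1 - \<alpha>\<^sub>1) * (1 + \<alpha>\<^sub>1) = 0" by (simp add: algebra_simps)
    then show False using n1 n2 by (auto simp: eq_neg_iff_add_eq_0 add.commute)
  qed
qed

definition no_ideal_list3 :: "'a::field family3 set" where
  "no_ideal_list3 =
     {A1_3 \<alpha>\<^sub>1 \<alpha>\<^sub>2 \<alpha>\<^sub>4 \<beta>\<^sub>1 | \<alpha>\<^sub>1 \<alpha>\<^sub>2 \<alpha>\<^sub>4 \<beta>\<^sub>1.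
        \<alpha>\<^sub>4 \<noteq> - \<alpha>\<^sub>1 - 2 * \<alpha>\<^sub>2 \<or> \<beta>\<^sub>1 \<noteq> 2 * \<alpha>\<^sub>1 + \<alpha>\<^sub>2} \<union>
     {A2_3 \<alpha>\<^sub>1 \<beta>\<^sub>1 \<beta>\<^sub>2 | \<alpha>\<^sub>1 \<beta>\<^sub>1 \<beta>\<^sub>2.
        (\<alpha>\<^sub>1 = 1 \<and> \<beta>\<^sub>1 \<noteq> 0 \<and> \<beta>\<^sub>2 = 0) \<or>
        (\<alpha>\<^sub>1 \<noteq> 1/2 \<and> \<alpha>\<^sub>1 \<noteq> 1 \<and> \<beta>\<^sub>1^2 + (\<alpha>\<^sub>1 - 1) * (2 * \<alpha>\<^sub>1 - 1)^2 \<noteq> 0 \<and> \<beta>\<^sub>2 = 1 - \<alpha>\<^sub>1) \<or>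
        (\<alpha>\<^sub>1 = 1/2 \<and> \<beta>\<^sub>2 = 1/2 \<and> \<beta>\<^sub>1 \<noteq> 0) \<or>
        \<beta>\<^sub>2 \<noteq> 1 - \<alpha>\<^sub>1} \<union>
     {A3_3 \<beta>\<^sub>1 \<beta>\<^sub>2 | \<beta>\<^sub>1 \<beta>\<^sub>2. (\<beta>\<^sub>1 \<noteq> -1 \<and> \<beta>\<^sub>2 = 1) \<or> \<beta>\<^sub>2 \<noteq> 1} \<union>
     {A6_3 \<alpha>\<^sub>1 \<beta>\<^sub>1 | \<alpha>\<^sub>1 \<beta>\<^sub>1. True} \<union>
     {A7_3 \<beta>\<^sub>1 | \<beta>\<^sub>1. True} \<union>
     {A9_3}"

fun same_class3 :: "'a::field family3 \<Rightarrow> 'a family3 \<Rightarrow> bool" where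
  "same_class3 (A2_3 \<alpha>\<^sub>1 \<beta>\<^sub>1 \<beta>\<^sub>2) (A2_3 \<alpha>\<^sub>1' \<beta>\<^sub>1' \<beta>\<^sub>2') \<longleftrightarrow>
     \<alpha>\<^sub>1' = \<alpha>\<^sub>1 \<and> (\<beta>\<^sub>1' = \<beta>\<^sub>1 \<or> \<beta>\<^sub>1' = - \<beta>\<^sub>1) \<and> \<beta>\<^sub>2' = \<beta>\<^sub>2"
| "same_class3 (A6_3 \<alpha>\<^sub>1 \<beta>\<^sub>1) (A6_3 \<alpha>\<^sub>1' \<beta>\<^sub>1') \<longleftrightarrow>
     \<alpha>\<^sub>1' = \<alpha>\<^sub>1 \<and> (\<beta>\<^sub>1' = \<beta>\<^sub>1 \<or> \<beta>\<^sub>1' = - \<beta>\<^sub>1)"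
| "same_class3 F G \<longleftrightarrow> F = G"

end

theory Submission
  imports Defs
begin

text \<open>Ideals: a line is spanned by \<open>e\<^sub>2\<close> or by exactly one \<open>e\<^sub>1 + t e\<^sub>2\<close>, and being an ideal is a
  condition on the structure constants, quadratic in \<open>t\<close>; the counts are the numbers of solutions.

  Classification: isomorphisms preserve the linear forms \<open>x \<mapsto> tr L\<^sub>x\<close> and \<open>x \<mapsto> tr R\<^sub>x\<close>. If they are
  independent, the dual basis is canonical and gives \<open>A\<^sub>1\<close>. If they are proportional and not both zero,
  take \<open>e\<^sub>2\<close> in their common kernel and normalize \<open>e\<^sub>1\<close>: \<open>e\<^sub>2 e\<^sub>2\<close> either has a nonzero
  \<open>e\<^sub>1\<close>-component, which a shear and a rescaling turn into \<open>e\<^sub>2 e\<^sub>2 = e\<^sub>1\<close> (families \<open>A\<^sub>2\<close>, \<open>A\<^sub>6\<close>), or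
  \<open>e\<^sub>2 e\<^sub>2\<close> is a multiple of \<open>e\<^sub>2\<close>, nonzero by simplicity (families \<open>A\<^sub>3\<close>, \<open>A\<^sub>7\<close>). If both traces
  vanish, a root of the binary cubic \<open>det(x, x x)\<close> provides an \<open>e\<^sub>2\<close> whose square is a multiple of
  itself, and one algebra remains. Because so few base changes preserve the normalized traces, the
  remaining parameters can be read off directly.\<close>

text \<open>Otherwise the power series coefficient notation competes with vector components.\<close>

no_notation fps_nth (infixl "$" 75)

section \<open>Isomorphisms\<close>

lemma linear_inv_bij:
  assumes "Vector_Spaces.linear s1 s2 f" and "bij f"
  shows "Vector_Spaces.linear s2 s1 (inv f)"
proof -
  interpret f: Vector_Spaces.linear s1 s2 f by fact
  have *: "f (inv f x) = x" for x using assms(2) by (simp add: bij_is_surj surj_f_inv_f)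
  have i: "inv f y = x \<longleftrightarrow> y = f x" for x y
    using assms(2) * by (metis bij_inv_eq_iff)
  show ?thesis
    unfolding Vector_Spaces.linear_iff i f.add f.scale *
    using f.vs1.vector_space_axioms f.vs2.vector_space_axioms by simp
qed

lemma algebra_isomorphic_sym:
  assumes "algebra_isomorphic s1 m1 s2 m2"
  shows "algebra_isomorphic s2 m2 s1 m1"
proof -
  obtain f where f: "Vector_Spaces.linear s1 s2 f" "bij f" and m: "\<And>x y. f (m1 x y) = m2 (f x) (f y)"
    using assms unfolding algebra_isomorphic_def by blast
  have "inv f (m2 x y) = m1 (inv f x) (inv f y)" for x y
    using m[of "inv f x" "inv f y"] f(2) by (metis bij_inv_eq_iff)
  then show ?thesis
    unfolding algebra_isomorphic_def using linear_inv_bij[OF f] bij_imp_bij_inv[OF f(2)] by blast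
qed

lemma algebra_isomorphic_trans [trans]:
  assumes "algebra_isomorphic s1 m1 s2 m2" and "algebra_isomorphic s2 m2 s3 m3"
  shows "algebra_isomorphic s1 m1 s3 m3"
proof -
  obtain f g where "Vector_Spaces.linear s1 s2 f" "bij f" "\<And>x y. f (m1 x y) = m2 (f x) (f y)"
    and "Vector_Spaces.linear s2 s3 g" "bij g" "\<And>x y. g (m2 x y) = m3 (g x) (g y)"
    using assms unfolding algebra_isomorphic_def by blast
  then show ?thesis unfolding algebra_isomorphic_def
    by (intro exI[of _ "g \<circ> f"]) (auto intro: Vector_Spaces.linear_compose bij_comp)
qed

text \<open>The inverse isomorphism carries the line of an ideal generator \<open>u\<close> onto the
  line of \<open>f u\<close>, which is again an ideal because every vector of the target is some
  \<open>f w\<close>.\<close>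

lemma algebra_isomorphic_nontrivial_ideals_empty:
  assumes iso: "algebra_isomorphic s1 m1 s2 m2" and e: "nontrivial_ideals s1 m1 = {}"
  shows "nontrivial_ideals s2 m2 = {}"
proof (rule ccontr)
  assume "nontrivial_ideals s2 m2 \<noteq> {}"
  then obtain u where u: "u \<noteq> 0" "\<And>v. m2 v u \<in> module.span s2 {u}" "\<And>v. m2 u v \<in> module.span s2 {u}"
    unfolding nontrivial_ideals_def by blast
  obtain f where f: "Vector_Spaces.linear s2 s1 f" "bij f" and m: "\<And>x y. f (m2 x y) = m1 (f x) (f y)"
    using algebra_isomorphic_sym[OF iso] unfolding algebra_isomorphic_def by blast
  interpret f: Vector_Spaces.linear s2 s1 f by fact
  have span: "f ` module.span s2 {u} = module.span s1 {f u}"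
    using f.span_image[of "{u}"] by simp
  have ideal: "m1 v (f u) \<in> module.span s1 {f u}" "m1 (f u) v \<in> module.span s1 {f u}" for v
  proof -
    obtain w where "v = f w" using f(2) by (metis bij_pointE)
    then show "m1 v (f u) \<in> module.span s1 {f u}" "m1 (f u) v \<in> module.span s1 {f u}"
      using u(2,3)[of w] by (simp_all flip: m span)
  qed
  have "f u \<noteq> 0" using u(1) f(2) by (metis bij_is_inj f.zero injD)
  then show False using e ideal unfolding nontrivial_ideals_def by blast
qed

section \<open>Coordinates and matrices of structure constants\<close>

lemma linear_vec_iff:
  "Vector_Spaces.linear (*s) (*s) (f :: 'a::field^'n \<Rightarrow> 'a^'m) \<longleftrightarrow>
     (\<forall>x y. f (x + y) = f x + f y) \<and> (\<forall>c x. f (c *s x) = c *s f x)"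
  by (simp add: Vector_Spaces.linear_iff vec.vector_space_axioms)

lemma algebra_isomorphic_refl: "msc_isomorphic A A"
  unfolding algebra_isomorphic_def by (rule exI[of _ id]) (simp add: linear_vec_iff)

lemma vec2_eq_iff: "(x :: 'a^2) = y \<longleftrightarrow> x$1 = y$1 \<and> x$2 = y$2"
  by (simp add: vec_eq_iff forall_2)

lemma vec2_decompose: "(x :: 'a::field^2) = x$1 *s axis 1 1 + x$2 *s axis 2 1"
  by (simp add: vec2_eq_iff axis_def)

lemma msc_entries:
  "A = msc [A$1$1, A$1$2, A$1$3, A$1$4] [A$2$1, A$2$2, A$2$3, A$2$4]"
  by (simp add: msc_def vec_eq_iff forall_2 forall_4 vector_def)

lemma msc_cases:
  obtains a1 a2 a3 a4 b1 b2 b3 b4 where "A = msc [a1, a2, a3, a4] [b1, b2, b3, b4]"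
  using msc_entries by (rule that)

lemma linear_msc_mult:
  "Vector_Spaces.linear (*s) (*s) (msc_mult A x)"
  "Vector_Spaces.linear (*s) (*s) (\<lambda>y. msc_mult A y x)"
proof -
  obtain a1 a2 a3 a4 b1 b2 b3 b4 where A: "A = msc [a1, a2, a3, a4] [b1, b2, b3, b4]"
    using msc_cases by blast
  show "Vector_Spaces.linear (*s) (*s) (msc_mult A x)"
    "Vector_Spaces.linear (*s) (*s) (\<lambda>y. msc_mult A y x)"
    unfolding A linear_vec_iff vec2_eq_iff msc_mult_nth vector_add_component vector_smult_component
    by (simp_all add: distrib_left distrib_right mult.assoc mult.left_commute add_ac)
qed

lemma two_dim_algebra_msc: "two_dim_algebra (*s) (msc_mult (A :: 'a::field^4^2))"
proof -
  have "vec.dim (UNIV :: ('a^2) set) = 2" using vec_dim_card[where 'n=2] by simp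
  then show ?thesis by (simp add: two_dim_algebra_def vec.vector_space_axioms linear_msc_mult)
qed

text \<open>The product is pulled back along \<open>g\<close>: the columns of \<open>B\<close> are
  the coordinates of the products of the images of the basis vectors, and bilinearity does the rest.
  This serves both abstract algebras and base changes of a given matrix.\<close>

lemma two_dim_algebra_coordinates:
  fixes scl :: "'a::field \<Rightarrow> 'v::ab_group_add \<Rightarrow> 'v" and g :: "'a^2 \<Rightarrow> 'v"
  assumes alg: "two_dim_algebra scl mul" and g: "Vector_Spaces.linear (*s) scl g" "bij g"
  obtains B where "\<And>x y. g (msc_mult B x y) = mul (g x) (g y)"
proof -
  let ?h = "inv g"
  let ?c = "\<lambda>i j k. ?h (mul (g (axis i 1)) (g (axis j 1))) $ k"
  define B where "B = msc [?c 1 1 1, ?c 1 2 1, ?c 2 1 1, ?c 2 2 1] [?c 1 1 2, ?c 1 2 2, ?c 2 1 2, ?c 2 2 2]"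
  interpret g: Vector_Spaces.linear "(*s)" scl g by fact
  interpret h: Vector_Spaces.linear scl "(*s)" ?h using linear_inv_bij g by blast
  have l: "mul u (v + w) = mul u v + mul u w" "mul u (scl c v) = scl c (mul u v)"
    "mul (v + w) u = mul v u + mul w u" "mul (scl c v) u = scl c (mul v u)" for u v w c
    using alg by (simp_all add: two_dim_algebra_def Vector_Spaces.linear_iff)
  have "?h (mul (g x) (g y)) = msc_mult B x y" for x y
  proof -
    have "?h (mul (g x) (g y)) = ?h (mul (g (x$1 *s axis 1 1 + x$2 *s axis 2 1)) (g (y$1 *s axis 1 1 + y$2 *s axis 2 1)))"
      by (simp flip: vec2_decompose)
    also have "\<dots> = msc_mult B x y"
      unfolding g.add g.scale l h.add h.scale
      by (simp add: vec2_eq_iff B_def msc_mult_nth algebra_simps)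
    finally show ?thesis .
  qed
  then have "g (msc_mult B x y) = mul (g x) (g y)" for x y
    using g(2) by (metis bij_inv_eq_iff)
  then show thesis using that by blast
qed

text \<open>A two-element basis gives the linear bijection along which
  \<open>two_dim_algebra_coordinates\<close> pulls back the product.\<close>

lemma two_dim_algebra_isomorphic_msc:
  assumes alg: "two_dim_algebra (scl :: 'a::field \<Rightarrow> 'v::ab_group_add \<Rightarrow> 'v) mul"
  obtains B where "algebra_isomorphic scl mul (*s) (msc_mult B)"
proof -
  have dim: "vector_space.dim scl UNIV = 2" and vs: "vector_space scl"
    using alg unfolding two_dim_algebra_def by auto
  interpret vector_space scl by fact
  obtain S where S: "independent S" "UNIV \<subseteq> span S" "card S = 2"
    using basis_exists[of UNIV] dim by metis
  then obtain b c where bc: "S = {b, c}" "b \<noteq> c" by (meson card_2_iff)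
  define g where "g = (\<lambda>x :: 'a^2. scl (x$1) b + scl (x$2) c)"
  have lin: "Vector_Spaces.linear (*s) scl g"
    unfolding Vector_Spaces.linear_iff g_def
    using vs vec.vector_space_axioms by (simp add: scale_left_distrib scale_right_distrib)
  interpret g: Vector_Spaces.linear "(*s)" scl g by fact
  have "g x = 0 \<Longrightarrow> x = 0" for x
  proof -
    assume "g x = 0"
    then have "scl (x$1) b + scl (x$2) c = 0" by (simp add: g_def)
    \<comment> \<open>Linear independence speaks of a coefficient function on \<open>S\<close>; as
      \<open>b\<close> and \<open>c\<close> differ, \<open>u\<close> takes both coordinates of
      \<open>x\<close> as values.\<close>
    moreover define u where "u = (\<lambda>v. if v = b then x$1 else x$2)"
    ultimately have "(\<Sum>v\<in>S. scl (u v) v) = 0" using bc by simp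
    then have "u b = 0" "u c = 0" using S(1) bc independentD[of S S u] by auto
    then show "x = 0" using bc(2) by (simp add: u_def vec2_eq_iff)
  qed
  then have inj: "inj g" using g.inj_iff_eq_0 by blast
  have "surj g"
  proof (unfold surj_def, intro allI)
    fix v
    have "v \<in> span {b, c}" using S(2) bc by blast
    then obtain k l where "v = scl k b + scl l c" unfolding span_insert span_singleton 
      by (force simp: algebra_simps)
    then have "g (vector [k, l]) = v" by (simp add: g_def vector_def)
    then show "\<exists>x. v = g x" by metis
  qed
  with inj have bij: "bij g" by (simp add: bij_def)
  obtain B where "\<And>x y. g (msc_mult B x y) = mul (g x) (g y)"
    using two_dim_algebra_coordinates[OF alg lin bij] by blast
  then have "algebra_isomorphic (*s) (msc_mult B) scl mul"
    unfolding algebra_isomorphic_def using lin bij by blast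
  then show thesis using that algebra_isomorphic_sym by blast
qed

text \<open>The matrix is listed by columns: \<open>(p, q)\<close> is the image of the first basis
  vector and \<open>(s, t)\<close> that of the second.\<close>

definition lin2 :: "'a::field \<Rightarrow> 'a \<Rightarrow> 'a \<Rightarrow> 'a \<Rightarrow> 'a^2 \<Rightarrow> 'a^2" where
  "lin2 p q s t x = vector [p * x$1 + s * x$2, q * x$1 + t * x$2]"

lemma lin2_nth [simp]: "lin2 p q s t x $ 1 = p * x$1 + s * x$2" "lin2 p q s t x $ 2 = q * x$1 + t * x$2"
  by (simp_all add: lin2_def vector_def)

lemma linear_lin2: "Vector_Spaces.linear (*s) (*s) (lin2 p q s t)"
  unfolding linear_vec_iff by (simp add: vec2_eq_iff algebra_simps)

lemma bij_lin2:
  fixes p :: "'a::field"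
  assumes "p * t - s * q \<noteq> 0"
  shows "bij (lin2 p q s t)"
proof -
  let ?D = "p * t - s * q"
  \<comment> \<open>The inverse is the adjugate matrix divided by the determinant.\<close>
  have 1: "lin2 (t / ?D) (- q / ?D) (- s / ?D) (p / ?D) (lin2 p q s t x) = x" for x
    using assms by (simp add: vec2_eq_iff divide_simps) (simp add: algebra_simps)
  have 2: "lin2 p q s t (lin2 (t / ?D) (- q / ?D) (- s / ?D) (p / ?D) x) = x" for x
    using assms by (simp add: vec2_eq_iff divide_simps) (simp add: algebra_simps)
  show ?thesis
    using o_bij[of "lin2 (t / ?D) (- q / ?D) (- s / ?D) (p / ?D)" "lin2 p q s t"]
    by (simp only: fun_eq_iff o_def id_def 1 2 simp_thms)
qed

lemma msc_isomorphicI: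
  assumes "p * t - s * q \<noteq> 0"
    and "\<And>x y. lin2 p q s t (msc_mult A x y) = msc_mult B (lin2 p q s t x) (lin2 p q s t y)"
  shows "msc_isomorphic A B"
  unfolding algebra_isomorphic_def
  by (intro exI[of _ "lin2 p q s t"] conjI allI linear_lin2 bij_lin2 assms)

section \<open>Traces\<close>

definition left_trace :: "'a::field^4^2 \<Rightarrow> 'a^2 \<Rightarrow> 'a" where
  "left_trace A x = trace (matrix (\<lambda>y. msc_mult A x y))"

definition right_trace :: "'a::field^4^2 \<Rightarrow> 'a^2 \<Rightarrow> 'a" where
  "right_trace A x = trace (matrix (\<lambda>y. msc_mult A y x))"

lemma left_trace_msc: "left_trace (msc [a1, a2, a3, a4] [b1, b2, b3, b4]) x = (a1 + b2) * x$1 + (a3 + b4) * x$2"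
  by (simp add: left_trace_def trace_def matrix_def sum_2 msc_mult_nth axis_def algebra_simps)

lemma right_trace_msc: "right_trace (msc [a1, a2, a3, a4] [b1, b2, b3, b4]) x = (a1 + b3) * x$1 + (a2 + b4) * x$2"
  by (simp add: right_trace_def trace_def matrix_def sum_2 msc_mult_nth axis_def algebra_simps)

text \<open>Here \<open>g\<close> is the conjugate of \<open>h\<close> by \<open>f\<close>, and the
  trace is invariant under cyclic permutation of a product.\<close>

lemma trace_matrix_conjugate:
  fixes f g h :: "'a::field^'n \<Rightarrow> 'a^'n"
  assumes "Vector_Spaces.linear (*s) (*s) f" "bij f"
    and "Vector_Spaces.linear (*s) (*s) g" "Vector_Spaces.linear (*s) (*s) h"
    and "\<And>x. f (g x) = h (f x)"
  shows "trace (matrix g) = trace (matrix h)"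
proof -
  have lin: "Vector_Spaces.linear (*s) (*s) (inv f)" using assms linear_inv_bij by blast
  have "g = inv f \<circ> (h \<circ> f)" by (simp add: fun_eq_iff bij_is_inj[OF assms(2)] flip: assms(5))
  then have "matrix g = matrix (inv f) ** (matrix h ** matrix f)"
    using matrix_compose_gen[OF Vector_Spaces.linear_compose[OF assms(1,4)] lin] matrix_compose_gen[OF assms(1,4)] by simp
  moreover have "matrix f ** matrix (inv f) = mat 1"
    using matrix_compose_gen[OF lin assms(1)] surj_iff[THEN iffD1, OF bij_is_surj[OF assms(2)]]
    by (simp add: matrix_id_mat_1)
  ultimately show ?thesis
    by (simp add: trace_mul_sym[of "matrix (inv f)"] flip: matrix_mul_assoc)
qed

lemma trace_isomorphism:
  fixes A :: "'a::field^4^2"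
  assumes "Vector_Spaces.linear (*s) (*s) f" "bij f" "\<And>x y. f (msc_mult A x y) = msc_mult B (f x) (f y)"
  shows "left_trace A x = left_trace B (f x)" and "right_trace A x = right_trace B (f x)"
proof -
  show "left_trace A x = left_trace B (f x)"
    unfolding left_trace_def
    using trace_matrix_conjugate[of f "msc_mult A x" "msc_mult B (f x)"] by (simp add: assms linear_msc_mult)
  show "right_trace A x = right_trace B (f x)"
    unfolding right_trace_def
    using trace_matrix_conjugate[of f "\<lambda>y. msc_mult A y x" "\<lambda>y. msc_mult B y (f x)"]
    by (simp add: assms linear_msc_mult)
qed

text \<open>The images of the basis vectors have coordinates \<open>(p, q)\<close> and
  \<open>(s, t)\<close>. The four trace equations are linear in them and usually determine most of
  the base change; the other eight compare coordinates of the images of the products of basis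
  vectors.\<close>

lemma msc_isomorphic_coordinates:
  assumes "msc_isomorphic (msc [a1, a2, a3, a4] [b1, b2, b3, b4]) (msc [c1, c2, c3, c4] [d1, d2, d3, d4])"
  obtains p q s t where
    "p \<noteq> 0 \<or> q \<noteq> 0" "s \<noteq> 0 \<or> t \<noteq> 0"
    "a1 + b2 = (c1 + d2) * p + (c3 + d4) * q" "a3 + b4 = (c1 + d2) * s + (c3 + d4) * t"
    "a1 + b3 = (c1 + d3) * p + (c2 + d4) * q" "a2 + b4 = (c1 + d3) * s + (c2 + d4) * t"
    "a1 * p + b1 * s = c1 * (p * p) + c2 * (p * q) + c3 * (q * p) + c4 * (q * q)"
    "a1 * q + b1 * t = d1 * (p * p) + d2 * (p * q) + d3 * (q * p) + d4 * (q * q)"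
    "a2 * p + b2 * s = c1 * (p * s) + c2 * (p * t) + c3 * (q * s) + c4 * (q * t)"
    "a2 * q + b2 * t = d1 * (p * s) + d2 * (p * t) + d3 * (q * s) + d4 * (q * t)"
    "a3 * p + b3 * s = c1 * (s * p) + c2 * (s * q) + c3 * (t * p) + c4 * (t * q)"
    "a3 * q + b3 * t = d1 * (s * p) + d2 * (s * q) + d3 * (t * p) + d4 * (t * q)"
    "a4 * p + b4 * s = c1 * (s * s) + c2 * (s * t) + c3 * (t * s) + c4 * (t * t)"
    "a4 * q + b4 * t = d1 * (s * s) + d2 * (s * t) + d3 * (t * s) + d4 * (t * t)"
proof -
  let ?A = "msc [a1, a2, a3, a4] [b1, b2, b3, b4]" and ?B = "msc [c1, c2, c3, c4] [d1, d2, d3, d4]"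
  let ?e = "axis 1 1 :: 'a^2" and ?e' = "axis 2 1 :: 'a^2"
  obtain f where f: "Vector_Spaces.linear (*s) (*s) f" "bij f" and m: "\<And>x y. f (msc_mult ?A x y) = msc_mult ?B (f x) (f y)"
    using assms unfolding algebra_isomorphic_def by blast
  interpret f: Vector_Spaces.linear "(*s)" "(*s)" f by fact
  have nz: "f x \<noteq> 0" if "x \<noteq> 0" for x using that f(2) by (metis bij_is_inj f.zero injD)
  have n: "f ?e $ 1 \<noteq> 0 \<or> f ?e $ 2 \<noteq> 0" "f ?e' $ 1 \<noteq> 0 \<or> f ?e' $ 2 \<noteq> 0"
    using nz[of ?e] nz[of ?e'] by (auto simp: vec2_eq_iff axis_eq_0_iff)
  note tr = trace_isomorphism[OF f m, unfolded left_trace_msc right_trace_msc]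
  have axis: "?e $ 1 = 1" "?e $ 2 = 0" "?e' $ 1 = 0" "?e' $ 2 = 1" by (simp_all add: axis_def)
  have eq: "f (msc_mult ?A x y) $ k = msc_mult ?B (f x) (f y) $ k" for x y k by (simp add: m)
  note simps = msc_mult_basis f.add f.scale msc_mult_nth axis vector_add_component vector_smult_component
  note E = eq[of ?e ?e 1, unfolded simps] eq[of ?e ?e 2, unfolded simps]
    eq[of ?e ?e' 1, unfolded simps] eq[of ?e ?e' 2, unfolded simps]
    eq[of ?e' ?e 1, unfolded simps] eq[of ?e' ?e 2, unfolded simps]
    eq[of ?e' ?e' 1, unfolded simps] eq[of ?e' ?e' 2, unfolded simps]
  note T = tr(1)[of ?e] tr(1)[of ?e'] tr(2)[of ?e] tr(2)[of ?e']
  show thesis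
    by (rule that[of "f ?e $ 1" "f ?e $ 2" "f ?e' $ 1" "f ?e' $ 2", OF n T[unfolded axis mult_1_right mult_zero_right add_0_left add_0_right] E])
qed

section \<open>Ideals\<close>

text \<open>The set \<open>T\<close> consists of the slopes \<open>t\<close> for which \<open>e\<^sub>1 + t e\<^sub>2\<close> spans an ideal; the
  remaining line \<open>e\<^sub>2\<close> accounts for the other summand.\<close>

lemma has_ideals_iff:
  "has_ideals (msc [a1, a2, a3, a4] [b1, b2, b3, b4] :: 'a::field^4^2) n \<longleftrightarrow>
     (let T = {t. b1 + t * b2 = t * (a1 + t * a2) \<and> b1 + t * b3 = t * (a1 + t * a3) \<and>
                  b3 + t * b4 = t * (a3 + t * a4) \<and> b2 + t * b4 = t * (a2 + t * a4)}
      in finite T \<and> card T + (if a2 = 0 \<and> a3 = 0 \<and> a4 = 0 then 1 else 0) = n)"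
proof -
  let ?A = "msc [a1, a2, a3, a4] [b1, b2, b3, b4]"
  define T where "T = {t. b1 + t * b2 = t * (a1 + t * a2) \<and> b1 + t * b3 = t * (a1 + t * a3) \<and>
    b3 + t * b4 = t * (a3 + t * a4) \<and> b2 + t * b4 = t * (a2 + t * a4)}"
  define V :: "('a^2) set" where "V = {w. w$1 = 0}"
  define L :: "'a \<Rightarrow> ('a^2) set" where "L = (\<lambda>t. {w. w$2 = t * w$1})"
  define S where "S = (if a2 = 0 \<and> a3 = 0 \<and> a4 = 0 then {V} else {})"
  have span_V: "vec.span {u} = V" if "u \<noteq> 0" "u$1 = 0" for u :: "'a^2"
  proof -
    have "u$2 \<noteq> 0" using that by (simp add: vec2_eq_iff)
    then have "w = (w$2 / u$2) *s u" if "w$1 = 0" for w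
      using that \<open>u$1 = 0\<close> by (simp add: vec2_eq_iff)
    then show ?thesis using \<open>u$1 = 0\<close> by (auto simp: V_def vec.span_singleton)
  qed
  have span_L: "vec.span {u} = L (u$2 / u$1)" if "u$1 \<noteq> 0" for u :: "'a^2"
  proof -
    have "w = (w$1 / u$1) *s u" if "w$2 = u$2 / u$1 * w$1" for w
      using that \<open>u$1 \<noteq> 0\<close> by (simp add: vec2_eq_iff)
    then show ?thesis using \<open>u$1 \<noteq> 0\<close> by (auto simp: L_def vec.span_singleton)
  qed
  have axis: "axis 1 1 $ 1 = (1::'a)" "axis 1 1 $ (2::2) = (0::'a)"
    "axis 2 1 $ (1::2) = (0::'a)" "axis 2 1 $ (2::2) = (1::'a)" by (simp_all add: axis_def)
  have "msc_ideals ?A = S \<union> L ` T"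
  proof (intro equalityI subsetI)
    fix I assume "I \<in> msc_ideals ?A"
    then obtain u where u: "u \<noteq> 0" "I = vec.span {u}"
      and 1: "\<And>v. msc_mult ?A v u \<in> I" "\<And>v. msc_mult ?A u v \<in> I"
      unfolding nontrivial_ideals_def by blast
    note eqs = 1(1)[of "axis 1 1"] 1(1)[of "axis 2 1"] 1(2)[of "axis 1 1"] 1(2)[of "axis 2 1"]
    show "I \<in> S \<union> L ` T"
    proof (cases "u$1 = 0")
      case True
      then have "u$2 \<noteq> 0" using u(1) by (simp add: vec2_eq_iff)
      then have "a2 = 0 \<and> a3 = 0 \<and> a4 = 0"
        using eqs True by (simp add: u(2) span_V[OF u(1) True]) (simp add: V_def msc_mult_nth axis)
      then show ?thesis using span_V[OF u(1) True] u(2) by (simp add: S_def)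
    next
      case False
      define t where "t = u$2 / u$1"
      have t: "u$2 = t * u$1" using False by (simp add: t_def)
      have I: "I = L t" using span_L[OF False] u(2) by (simp add: t_def)
      \<comment> \<open>Membership of the four products in the line gives the equations that define
        \<open>T\<close>, multiplied by \<open>u$1\<close>.\<close>
      have cancel: "x = y" if "u$1 * x = u$1 * y" for x y using that False by simp
      have "t \<in> T"
        unfolding T_def mem_Collect_eq
        apply (intro conjI; rule cancel)
        using eqs unfolding I L_def mem_Collect_eq msc_mult_nth axis t
        by (simp_all add: algebra_simps)
      then show ?thesis using I by blast
    qed
  next
    fix I assume "I \<in> S \<union> L ` T"
    then consider "I = V" "a2 = 0" "a3 = 0" "a4 = 0" | t where "t \<in> T" "I = L t"
      by (auto simp: S_def split: if_splits)
    then show "I \<in> msc_ideals ?A"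
    proof cases
      case 1
      let ?u = "axis 2 1 :: 'a^2"
      have "?u \<noteq> 0" "?u $ 1 = 0" by (simp_all add: axis axis_eq_0_iff)
      then have "I = vec.span {?u}" using 1(1) span_V by simp
      moreover have "msc_mult ?A v ?u \<in> I \<and> msc_mult ?A ?u v \<in> I" for v
        by (simp add: 1 V_def msc_mult_nth axis)
      ultimately show ?thesis using \<open>?u \<noteq> 0\<close> unfolding nontrivial_ideals_def by blast
    next
      case 2
      let ?u = "vector [1, t] :: 'a^2"
      have u: "?u $ 1 = 1" "?u $ 2 = t" by simp_all
      have "?u \<noteq> 0" using u(1) by (metis zero_index zero_neq_one)
      have "I = vec.span {?u}" using 2(2) span_L[of ?u] by simp
      moreover have "msc_mult ?A v ?u \<in> I \<and> msc_mult ?A ?u v \<in> I" for v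
      proof -
        have e: "b1 + t * b2 = t * (a1 + t * a2)" "b1 + t * b3 = t * (a1 + t * a3)"
          "b3 + t * b4 = t * (a3 + t * a4)" "b2 + t * b4 = t * (a2 + t * a4)"
          using 2(1) by (simp_all add: T_def)
        \<comment> \<open>Products with \<open>u\<close> are linear in \<open>v\<close>, so the
          conditions at the two basis vectors combine to the condition at \<open>v\<close>.\<close>
        have "v$1 * (b1 + t * b2) + v$2 * (b3 + t * b4) =
            v$1 * (t * (a1 + t * a2)) + v$2 * (t * (a3 + t * a4))"
          "v$1 * (b1 + t * b3) + v$2 * (b2 + t * b4) =
            v$1 * (t * (a1 + t * a3)) + v$2 * (t * (a2 + t * a4))"
          unfolding e by rule+
        then show ?thesis
          unfolding 2(2) L_def mem_Collect_eq msc_mult_nth u by (simp add: algebra_simps)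
      qed
      ultimately show ?thesis using \<open>?u \<noteq> 0\<close> unfolding nontrivial_ideals_def by blast
    qed
  qed
  moreover have inj: "inj_on L T"
  proof (rule inj_onI)
    fix s t assume "L s = L t"
    moreover have "(vector [1, s] :: 'a^2) \<in> L s" by (simp add: L_def)
    ultimately show "s = t" by (simp add: L_def)
  qed
  moreover have "S \<inter> L ` T = {}"
  proof -
    have "(vector [0, 1] :: 'a^2) \<in> V" "(vector [0, 1] :: 'a^2) \<notin> L t" for t
      by (simp_all add: V_def L_def)
    then have "V \<noteq> L t" for t by blast
    then show ?thesis by (auto simp: S_def)
  qed
  moreover have "finite S" by (simp add: S_def)
  \<comment> \<open>Distinct slopes give distinct lines, none of them vertical, so the cardinalities
    add up.\<close>
  ultimately have "has_ideals ?A n \<longleftrightarrow> finite T \<and> card S + card T = n"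
    unfolding has_ideals_def
    by (metis card_Un_disjoint card_image finite_Un finite_image_iff)
  then show ?thesis by (simp add: Let_def S_def T_def add.commute)
qed

lemma msc_ideals_empty_iff: "msc_ideals A = {} \<longleftrightarrow> has_ideals A 0"
  by (auto simp: has_ideals_def)

text \<open>If the product were zero, every line would be an ideal; hence the absence of ideals
  already forces a nonzero product.\<close>

lemma msc_simple_iff: "msc_simple (A :: 'a::field^4^2) \<longleftrightarrow> has_ideals A 0"
proof
  assume "has_ideals A 0"
  then have e: "msc_ideals A = {}" by (simp add: msc_ideals_empty_iff)
  have "\<exists>x y. msc_mult A x y \<noteq> 0"
  proof (rule ccontr)
    assume "\<not> ?thesis"
    then have z: "msc_mult A x y = 0" for x y by blast
    have "axis 1 1 \<noteq> (0 :: 'a^2)" by (simp add: axis_eq_0_iff)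
    then have "vec.span {axis 1 1 :: 'a^2} \<in> msc_ideals A"
      unfolding nontrivial_ideals_def z using vec.span_zero by blast
    with e show False by blast
  qed
  with e show "msc_simple A" by (simp add: simple_two_dim_algebra_def two_dim_algebra_msc)
qed (simp add: simple_two_dim_algebra_def msc_ideals_empty_iff)

lemma has_idealsI:
  assumes "\<And>t. b1 + t * b2 = t * (a1 + t * a2) \<and> b1 + t * b3 = t * (a1 + t * a3) \<and>
      b3 + t * b4 = t * (a3 + t * a4) \<and> b2 + t * b4 = t * (a2 + t * a4) \<longleftrightarrow> t \<in> T"
    and "finite T" and "card T + (if a2 = 0 \<and> a3 = 0 \<and> a4 = 0 then 1 else 0) = n"
  shows "has_ideals (msc [a1, a2, a3, a4] [b1, b2, b3, b4] :: 'a::field^4^2) n"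
  using assms by (simp add: has_ideals_iff Let_def)

text \<open>The third and fourth conditions differ by \<open>1\<close> on the left and by
  \<open>t\<close> on the right, so \<open>t = 1\<close>; at this slope the others become the two
  linear relations.\<close>

lemma slope_A1:
  fixes a1 :: "'a::field"
  shows "(b1 + t * - a1 = t * (a1 + t * a2) \<and> b1 + t * (- a1 + 1) = t * (a1 + t * (a2 + 1)) \<and>
      (- a1 + 1) + t * - a2 = t * ((a2 + 1) + t * a4) \<and> - a1 + t * - a2 = t * (a2 + t * a4)) \<longleftrightarrow>
    t = 1 \<and> a4 = - a1 - 2 * a2 \<and> b1 = 2 * a1 + a2" (is "?l \<longleftrightarrow> ?r")
proof
  assume l: ?l
  have "1 = ((- a1 + 1) + t * - a2) - (- a1 + t * - a2)" by simp
  also have "\<dots> = t * ((a2 + 1) + t * a4) - t * (a2 + t * a4)" using l by metis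
  also have "\<dots> = t" by (simp add: algebra_simps)
  finally have t: "t = 1" ..
  have "b1 - a1 = a1 + a2" "- a1 - a2 = a2 + a4" using l unfolding t by simp_all
  then show ?r by (simp add: t algebra_simps)
next
  assume ?r then show ?l by (simp add: algebra_simps)
qed

text \<open>The last two conditions say \<open>1 - a1 = t^2 = b2\<close>, and the second then yields
  \<open>b1\<close>. At most one slope remains if \<open>2 * a1 - 1\<close> is nonzero; otherwise
  the slopes, if any, are the square roots of \<open>1 - a1\<close>.\<close>

lemma slope_A2:
  fixes a1 :: "'a::field"
  shows "(b1 + t * b2 = t * (a1 + t * 0) \<and> b1 + t * (1 - a1) = t * (a1 + t * 0) \<and>
      (1 - a1) + t * 0 = t * (0 + t * 1) \<and> b2 + t * 0 = t * (0 + t * 1)) \<longleftrightarrow>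
    b2 = 1 - a1 \<and> 1 - a1 = t^2 \<and> b1 = t * (2 * a1 - 1)" (is "?l \<longleftrightarrow> ?r")
proof
  assume l: ?l
  then have "b1 = t * a1 - t * (1 - a1)" by (simp add: algebra_simps)
  then show ?r using l by (simp add: power2_eq_square algebra_simps)
next
  assume r: ?r
  then have "b2 = t * t" "1 - a1 = t * t" by (simp_all add: power2_eq_square)
  moreover have "b1 + t * (1 - a1) = t * a1" using r by (simp add: algebra_simps)
  ultimately show ?l by simp
qed

section \<open>Ideal counts for the families shared by both characteristics\<close>

lemma has_ideals_A1_0:
  fixes a1 :: "'a::field"
  assumes "a4 \<noteq> - a1 - 2 * a2 \<or> b1 \<noteq> 2 * a1 + a2"
  shows "has_ideals (msc [a1, a2, a2 + 1, a4] [b1, - a1, - a1 + 1, - a2]) 0"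
  by (rule has_idealsI[where T = "{}"], unfold slope_A1) (use assms in auto)

lemma has_ideals_A1_1:
  fixes a1 :: "'a::field"
  assumes "a4 = - a1 - 2 * a2" "b1 = 2 * a1 + a2"
  shows "has_ideals (msc [a1, a2, a2 + 1, a4] [b1, - a1, - a1 + 1, - a2]) 1"
  by (rule has_idealsI[where T = "{1}"], unfold slope_A1) (use assms in auto)

lemma has_ideals_A2:
  fixes a1 :: "'a::field"
  assumes "finite T" and "\<And>t. b2 = 1 - a1 \<and> 1 - a1 = t^2 \<and> b1 = t * (2 * a1 - 1) \<longleftrightarrow> t \<in> T"
    and "card T = n"
  shows "has_ideals (msc [a1, 0, 0, 1] [b1, b2, 1 - a1, 0]) n"
  by (rule has_idealsI[where T = T], unfold slope_A2) (use assms in simp_all)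

text \<open>The second basis vector always spans an ideal; the only other candidate is slope
  \<open>0\<close>, which requires \<open>1 - a1 = 0\<close> and \<open>b2 = 0\<close>.\<close>

lemma has_ideals_A4:
  fixes a1 :: "'a::field"
  shows "has_ideals (msc [a1, 0, 0, 0] [0, b2, 1 - a1, 0]) (if a1 = 1 \<and> b2 = 0 then 2 else 1)"
  by (intro has_idealsI[where T = "if a1 = 1 \<and> b2 = 0 then {0} else {}"]) auto

text \<open>The last two slope conditions would make both \<open>- a1\<close> and
  \<open>1 - a1\<close> equal to \<open>t^2\<close>.\<close>

lemma has_ideals_A6:
  "has_ideals (msc [a1, 0, 0, 1] [b1, 1 - a1, - a1, 0] :: 'a::field^4^2) 0"
proof (rule has_idealsI[where T = "{}"])
  fix t
  show "b1 + t * (1 - a1) = t * (a1 + t * 0) \<and> b1 + t * - a1 = t * (a1 + t * 0) \<and>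
    - a1 + t * 0 = t * (0 + t * 1) \<and> 1 - a1 + t * 0 = t * (0 + t * 1) \<longleftrightarrow> t \<in> {}"
    by (auto simp: algebra_simps)
qed simp_all

lemma has_ideals_A8:
  "has_ideals (msc [a1, 0, 0, 0] [0, 1 - a1, - a1, 0] :: 'a::field^4^2) 1"
  by (rule has_idealsI[where T = "{}"]) auto

lemma has_ideals_A12: "has_ideals (msc [0, 0, 0, 0] [1, 0, 0, 0] :: 'a::field^4^2) 1"
  by (rule has_idealsI[where T = "{}"]) auto

text \<open>The slope conditions contain \<open>0 = t^2\<close>, so the first basis vector spans the
  only ideal, in every characteristic.\<close>

lemma has_ideals_A10: "has_ideals (msc [0, 1, 1, 0] [0, 0, 0, -1] :: 'a::field^4^2) 1"
  by (rule has_idealsI[where T = "{0}"]) auto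

section \<open>Ideal counts in characteristic 2\<close>

lemma CHAR_2_simps:
  assumes "CHAR('a::field) = 2"
  shows "(2::'a) = 0" "- x = (x::'a)" "x - y = x + (y::'a)" "x + x = (0::'a)" "x + (x + y) = (y::'a)"
proof -
  show two: "(2::'a) = 0" using of_nat_CHAR[where 'a='a] assms by simp
  show m: "x + x = (0::'a)" for x :: 'a using two by (metis mult_2 mult_zero_left)
  show "- x = x" "x - y = x + y" by (simp_all add: assms uminus_CHAR_2 minus_CHAR_2)
  show "x + (x + y) = y" by (simp add: m flip: add.assoc)
qed

lemma CHAR_2_eq_iff:
  assumes "CHAR('a::field) = 2"
  shows "(x::'a) = y \<longleftrightarrow> x + y = 0"
  using CHAR_2_simps(2,4)[OF assms] by (metis add_eq_0_iff)

text \<open>In characteristic 2 the factor \<open>2 * a1 - 1\<close> is \<open>1\<close>, so the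
  only possible slope is \<open>b1\<close> itself.\<close>

lemma has_ideals_A2_2:
  fixes a1 :: "'a::field"
  assumes c: "CHAR('a) = 2"
  shows "has_ideals (msc2 (A2_2 a1 b1 b2)) (if b2 = 1 - a1 \<and> 1 - a1 + b1^2 = 0 then 1 else 0)"
proof -
  have "(b2 = 1 - a1 \<and> 1 - a1 = t^2 \<and> b1 = t * (2 * a1 - 1)) \<longleftrightarrow>
    t \<in> (if b2 = 1 - a1 \<and> 1 - a1 + b1^2 = 0 then {b1} else {})" for t
    using CHAR_2_eq_iff[OF c, of "1 - a1" "t^2"] by (auto simp: CHAR_2_simps[OF c])
  then show ?thesis by (simp only: msc2.simps) (rule has_ideals_A2, auto)
qed

text \<open>The last two slope conditions reduce to \<open>a1 = 1\<close> and \<open>b2 = 0\<close>;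
  what remains is \<open>t * (1 + t) = 0\<close>, whose roots in characteristic 2 are
  \<open>0\<close> and \<open>1\<close>.\<close>

lemma has_ideals_A3_2:
  fixes a1 :: "'a::field"
  assumes c: "CHAR('a) = 2"
  shows "has_ideals (msc2 (A3_2 a1 b2)) (if a1 = 1 \<and> b2 = 0 then 2 else 0)"
  unfolding msc2.simps
proof (rule has_idealsI[where T = "if a1 = 1 \<and> b2 = 0 then {0, 1} else {}"])
  fix t
  have "a1 = 1" if "1 - a1 + t * 1 = t * (1 + t * 0)" using that by simp
  moreover have "t = 0 \<or> t = 1" if "0 + t * 0 = t * (1 + t * 1)"
    using that CHAR_2_eq_iff[OF c, of t 1] by (auto simp: add.commute)
  ultimately show "(0 + t * b2 = t * (a1 + t * 1) \<and> 0 + t * (1 - a1) = t * (a1 + t * 1) \<and>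
    1 - a1 + t * 1 = t * (1 + t * 0) \<and> b2 + t * 1 = t * (1 + t * 0)) \<longleftrightarrow>
    t \<in> (if a1 = 1 \<and> b2 = 0 then {0, 1} else {})"
    using CHAR_2_simps(1)[OF c] by auto
qed auto

lemma has_ideals_A5_2: "has_ideals (msc2 (A5_2 a1 :: 'a::field family2)) 1"
  unfolding msc2.simps by (rule has_idealsI[where T = "{}"]) auto

lemma has_ideals_A7_2: "has_ideals (msc2 (A7_2 a1 :: 'a::field family2)) 0"
  unfolding msc2.simps
  by (rule has_idealsI[where T = "{}"]) (auto simp: algebra_simps)

lemma has_ideals_A9_2: "has_ideals (msc2 (A9_2 :: 'a::field family2)) 1"
  unfolding msc2.simps by (rule has_idealsI[where T = "{}"]) auto

text \<open>One slope condition is \<open>-1 - t = t\<close>, which is impossible when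
  \<open>2 = 0\<close>.\<close>

lemma has_ideals_A11_2:
  assumes c: "CHAR('a::field) = 2"
  shows "has_ideals (msc2 (A11_2 :: 'a family2)) 0"
  unfolding msc2.simps
  by (rule has_idealsI[where T = "{}"]) (auto simp: CHAR_2_simps[OF c] algebra_simps)

section \<open>Ideal counts in characteristic 3\<close>

lemma CHAR_3_simps:
  assumes "CHAR('a::field) = 3"
  shows "(3::'a) = 0" "(2::'a) = -1" "(2::'a) \<noteq> 0" "1/2 = (-1::'a)" "(1::'a) \<noteq> -1"
proof -
  show "(3::'a) = 0" using of_nat_CHAR[where 'a='a] assms by simp
  then have "(2::'a) + 1 = 0" by simp
  then show two: "(2::'a) = -1" by (simp add: eq_neg_iff_add_eq_0)
  show "1/2 = (-1::'a)" by (simp add: two)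
  show "(2::'a) \<noteq> 0" by (simp add: two)
  then show "(1::'a) \<noteq> -1" by (metis add.right_inverse one_add_one)
qed

lemma half_eq_CHAR_3:
  assumes "CHAR('a::field) = 3"
  shows "1 - 1/2 = (1/2::'a)"
  using CHAR_3_simps(3)[OF assms] by (simp add: field_simps)

lemma half_neq_1_CHAR_3:
  assumes "CHAR('a::field) = 3"
  shows "1/2 \<noteq> (1::'a)"
  using CHAR_3_simps(5)[OF assms] unfolding CHAR_3_simps(4)[OF assms] by (rule not_sym)

text \<open>Squaring \<open>b1 = t * (2 * a1 - 1)\<close> and inserting \<open>t^2 = 1 - a1\<close>
  eliminates the slope; each listed case violates the resulting equation or
  \<open>b2 = 1 - a1\<close>.\<close>

lemma has_ideals_A2_3_0:
  fixes a1 :: "'a::field"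
  assumes c: "CHAR('a) = 3"
    and "(a1 = 1 \<and> b1 \<noteq> 0 \<and> b2 = 0) \<or>
         (a1 \<noteq> 1/2 \<and> a1 \<noteq> 1 \<and> b1^2 + (a1 - 1) * (2 * a1 - 1)^2 \<noteq> 0 \<and> b2 = 1 - a1) \<or>
         (a1 = 1/2 \<and> b2 = 1/2 \<and> b1 \<noteq> 0) \<or> b2 \<noteq> 1 - a1"
  shows "has_ideals (msc3 (A2_3 a1 b1 b2)) 0"
proof -
  have "\<not> (b2 = 1 - a1 \<and> 1 - a1 = t^2 \<and> b1 = t * (2 * a1 - 1))" for t
  proof
    assume l: "b2 = 1 - a1 \<and> 1 - a1 = t^2 \<and> b1 = t * (2 * a1 - 1)"
    then have "a1 - 1 = - (t^2)" by (simp add: algebra_simps)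
    then have "b1^2 + (a1 - 1) * (2 * a1 - 1)^2 = 0" using l by (simp add: power_mult_distrib)
    with assms(2) l show False using CHAR_3_simps[OF c] by auto
  qed
  then show ?thesis unfolding msc3.simps by (intro has_ideals_A2[where T = "{}"]) auto
qed

text \<open>In both cases \<open>a1\<close> differs from \<open>1/2\<close>, so the slope is forced
  to be \<open>b1 / (2 * a1 - 1)\<close>, and the equation for \<open>b1^2\<close> says that its
  square is \<open>1 - a1\<close>.\<close>

lemma has_ideals_A2_3_1:
  fixes a1 :: "'a::field"
  assumes c: "CHAR('a) = 3"
    and a: "(a1 = 1 \<and> b1 = 0 \<and> b2 = 0) \<or>
      (a1 \<noteq> 1/2 \<and> a1 \<noteq> 1 \<and> b2 = 1 - a1 \<and> b1^2 + (a1 - 1) * (2 * a1 - 1)^2 = 0)"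
  shows "has_ideals (msc3 (A2_3 a1 b1 b2)) 1"
proof -
  define d where "d = 2 * a1 - 1"
  have d: "d \<noteq> 0"
  proof
    assume "d = 0"
    then have "a1 = 1/2" using CHAR_3_simps(3)[OF c] by (simp add: d_def field_simps)
    moreover have "1 \<noteq> (1/2::'a)" unfolding CHAR_3_simps(4)[OF c] by (rule CHAR_3_simps(5)[OF c])
    ultimately show False using a by auto
  qed
  have "1 - a1 = (b1 / d)^2"
  proof -
    have "b1^2 + (a1 - 1) * d^2 = 0" using a by (auto simp: d_def)
    then have "b1^2 = (1 - a1) * d^2" by (simp add: algebra_simps)
    then show ?thesis using d by (simp add: power_divide)
  qed
  moreover have "b2 = 1 - a1" using a by auto
  moreover have "b1 = t * (2 * a1 - 1) \<longleftrightarrow> t = b1 / d" for t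
    using d by (auto simp: d_def[symmetric])
  ultimately show ?thesis unfolding msc3.simps
    by (intro has_ideals_A2[where T = "{b1 / d}"]) auto
qed

text \<open>At \<open>a1 = 1/2\<close> the condition on \<open>b1\<close> no longer restricts the
  slope. Since \<open>1/2 = -1\<close> in characteristic 3, the slopes are the two square roots of
  \<open>-1\<close>.\<close>

lemma has_ideals_A2_3_2:
  fixes a1 :: "'a::field"
  assumes c: "CHAR('a) = 3" and a: "a1 = 1/2" "b2 = 1/2" "b1 = 0" and i: "i^2 = (-1::'a)"
  shows "has_ideals (msc3 (A2_3 a1 b1 b2)) 2"
proof -
  have "i \<noteq> 0" using i by auto
  then have "i \<noteq> - i" using CHAR_3_simps(3)[OF c] by (metis add_eq_0_iff mult_2 mult_eq_0_iff)
  moreover have "(b2 = 1 - a1 \<and> 1 - a1 = t^2 \<and> b1 = t * (2 * a1 - 1)) \<longleftrightarrow> t \<in> {i, - i}" for t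
  proof -
    have "2 * (1/2) = (1::'a)" using CHAR_3_simps(3)[OF c] by simp
    then have "2 * a1 - 1 = 0" by (simp only: a diff_self)
    moreover have "1 - a1 = -1"
      unfolding a(1) CHAR_3_simps(4)[OF c] using CHAR_3_simps(2)[OF c] by simp
    moreover have "b2 = -1" unfolding a(2) by (rule CHAR_3_simps(4)[OF c])
    moreover have "-1 = t^2 \<longleftrightarrow> t = i \<or> t = - i" unfolding i[symmetric] power2_eq_iff[symmetric] by metis
    ultimately show ?thesis using a(3) by simp
  qed
  ultimately show ?thesis unfolding msc3.simps
    by (intro has_ideals_A2[where T = "{i, - i}"]) simp_all
qed

text \<open>The third condition \<open>1 - t = t\<close> forces \<open>t = 1/2 = -1\<close>; the
  others then give \<open>b2 = 2 * t = 1\<close> and \<open>b1 = t^2 - t = 2 = -1\<close>.\<close>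

lemma has_ideals_A3_3:
  assumes c: "CHAR('a::field) = 3"
  shows "has_ideals (msc3 (A3_3 b1 b2 :: 'a family3)) (if b1 = -1 \<and> b2 = 1 then 1 else 0)"
  unfolding msc3.simps
proof (rule has_idealsI[where T = "if b1 = -1 \<and> b2 = 1 then {-1} else {}"])
  fix t
  show "(b1 + t * b2 = t * (0 + t * 1) \<and> b1 + t * 1 = t * (0 + t * 1) \<and>
    1 + t * - 1 = t * (1 + t * 0) \<and> b2 + t * - 1 = t * (1 + t * 0)) \<longleftrightarrow>
    t \<in> (if b1 = -1 \<and> b2 = 1 then {-1} else {})" (is "?l \<longleftrightarrow> ?r")
  proof
    assume l: ?l
    then have "t + t = 1" by (simp add: algebra_simps)
    then have "t * 2 = 1" by (simp add: mult_2_right)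
    then have "t * -1 = 1" by (simp only: CHAR_3_simps(2)[OF c])
    then have t: "t = -1" by (metis minus_equation_iff mult_minus1_right)
    have "b2 - t = t" "b1 + t = t * t" using l by simp_all
    then have "b2 = t + t" "b1 = t * t - t" by (simp_all add: diff_eq_eq eq_diff_eq)
    then have "b2 = 1" "b1 = 2" using \<open>t + t = 1\<close> by (simp_all add: t)
    then show ?r unfolding t CHAR_3_simps(2)[OF c] by simp
  next
    assume ?r
    then have "t = -1" "b1 = -1" "b2 = 1" by (simp_all split: if_splits)
    then show ?l using CHAR_3_simps(2)[OF c] by simp
  qed
qed auto

lemma has_ideals_A5_3:
  assumes c: "CHAR('a::field) = 3"
  shows "has_ideals (msc3 (A5_3 a1 :: 'a family3)) 1"
  unfolding msc3.simps
proof (rule has_idealsI[where T = "{}"])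
  fix t
  have False if "1 - a1 + t * 0 = t * (0 + t * 0)" "-1 - a1 + t * 0 = t * (0 + t * 0)"
  proof -
    have "1 - a1 = -1 - a1" using that by simp
    then show False using CHAR_3_simps(5)[OF c] by simp
  qed
  then show "(1 + t * (- 1 - a1) = t * (a1 + t * 0) \<and> 1 + t * (1 - a1) = t * (a1 + t * 0) \<and>
      1 - a1 + t * 0 = t * (0 + t * 0) \<and> - 1 - a1 + t * 0 = t * (0 + t * 0)) \<longleftrightarrow> t \<in> {}" by blast
qed simp_all

lemma has_ideals_A7_3: "has_ideals (msc3 (A7_3 b1 :: 'a::field family3)) 0"
  unfolding msc3.simps
proof (rule has_idealsI[where T = "{}"])
  fix t
  have False if "b1 + t * 1 = t * (0 + t * 1)" "b1 + t * 0 = t * (0 + t * 1)" "1 + t * -1 = t * (1 + t * 0)"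
  proof -
    have "b1 + t = b1" using that(1,2) by simp
    then have "t = 0" by simp
    then show False using that(3) by simp
  qed
  then show "(b1 + t * 1 = t * (0 + t * 1) \<and> b1 + t * 0 = t * (0 + t * 1) \<and>
      0 + t * - 1 = t * (1 + t * 0) \<and> 1 + t * - 1 = t * (1 + t * 0)) \<longleftrightarrow> t \<in> {}" by blast
qed simp_all

text \<open>The conditions \<open>- t = t\<close> and \<open>1 = t^2\<close> contradict each other
  when \<open>2\<close> is invertible.\<close>

lemma has_ideals_A9_3:
  assumes c: "CHAR('a::field) = 3"
  shows "has_ideals (msc3 (A9_3 :: 'a family3)) 0"
  unfolding msc3.simps
proof (rule has_idealsI[where T = "{}"])
  fix t :: 'a
  have False if "1 + t * 0 = t * (0 + t * 1)" "0 + t * -1 = t * (1 + t * 0)"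
  proof -
    have "t * -1 = t * 1" using that(2) by simp
    then have "t = 0" using CHAR_3_simps(5)[OF c] by (metis mult_cancel_left)
    then show False using that(1) by simp
  qed
  then show "(1 + t * 0 = t * (0 + t * 1) \<and> 1 + t * 0 = t * (0 + t * 1) \<and>
      0 + t * - 1 = t * (1 + t * 0) \<and> 0 + t * - 1 = t * (1 + t * 0)) \<longleftrightarrow> t \<in> {}" by blast
qed simp_all

lemma has_ideals_A11_3: "has_ideals (msc3 (A11_3 :: 'a::field family3)) 1"
  unfolding msc3.simps by (rule has_idealsI[where T = "{}"]) auto

section \<open>Normal forms\<close>

text \<open>The traces of the new matrix are the values of the old trace forms at the new basis
  vectors \<open>(p, q)\<close> and \<open>(s, t)\<close>. A basis can thus be chosen by prescribing
  these values.\<close>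

lemma msc_change_of_basis:
  fixes A :: "'a::field^4^2"
  assumes "p * t - s * q \<noteq> 0"
  obtains c1 c2 c3 c4 d1 d2 d3 d4 where
    "msc_isomorphic A (msc [c1, c2, c3, c4] [d1, d2, d3, d4])"
    "c1 + d2 = left_trace A (vector [p, q])" "c3 + d4 = left_trace A (vector [s, t])"
    "c1 + d3 = right_trace A (vector [p, q])" "c2 + d4 = right_trace A (vector [s, t])"
proof -
  let ?f = "lin2 p q s t"
  obtain B where B: "\<And>x y. ?f (msc_mult B x y) = msc_mult A (?f x) (?f y)"
    using two_dim_algebra_coordinates[OF two_dim_algebra_msc linear_lin2 bij_lin2[OF assms]] by blast
  obtain c1 c2 c3 c4 d1 d2 d3 d4 where B': "B = msc [c1, c2, c3, c4] [d1, d2, d3, d4]"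
    using msc_cases by blast
  have "msc_isomorphic B A" by (rule msc_isomorphicI[OF assms B])
  then have iso: "msc_isomorphic A (msc [c1, c2, c3, c4] [d1, d2, d3, d4])"
    unfolding B' by (rule algebra_isomorphic_sym)
  have v: "?f (vector [1, 0]) = vector [p, q]" "?f (vector [0, 1]) = vector [s, t]"
    by (simp_all add: vec2_eq_iff)
  note tr = trace_isomorphism[OF linear_lin2 bij_lin2[OF assms] B]
  show thesis
  proof (rule that[OF iso])
    show "c1 + d2 = left_trace A (vector [p, q])" "c3 + d4 = left_trace A (vector [s, t])"
      "c1 + d3 = right_trace A (vector [p, q])" "c2 + d4 = right_trace A (vector [s, t])"
      unfolding v[symmetric] tr[symmetric] by (simp_all add: B' left_trace_msc right_trace_msc)
  qed
qed

text \<open>The new basis is dual to the right and left trace forms, by Cramer's rule: the right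
  trace is \<open>1\<close> on the first vector and \<open>0\<close> on the second, the left trace
  the reverse.\<close>

lemma normal_form_independent_traces:
  fixes A :: "'a::field^4^2"
  assumes A: "A = msc [a1, a2, a3, a4] [b1, b2, b3, b4]"
    and indep: "(a1 + b3) * (a3 + b4) - (a2 + b4) * (a1 + b2) \<noteq> 0"
  obtains c1 c2 c4 d1 where
    "msc_isomorphic A (msc [c1, c2, c2 + 1, c4] [d1, - c1, - c1 + 1, - c2])"
proof -
  define r1 r2 l1 l2 where "r1 = a1 + b3" "r2 = a2 + b4" "l1 = a1 + b2" "l2 = a3 + b4"
  note defs = this
  define D where "D = r1 * l2 - r2 * l1"
  have D: "D \<noteq> 0" using indep by (simp add: D_def defs)
  have "l2 / D * (r1 / D) - (- r2 / D) * (- l1 / D) = D / D^2"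
    by (simp add: D_def power2_eq_square diff_divide_distrib algebra_simps)
  then have "l2 / D * (r1 / D) - (- r2 / D) * (- l1 / D) \<noteq> 0" using D by simp
  then obtain c1 c2 c3 c4 d1 d2 d3 d4 where iso: "msc_isomorphic A (msc [c1, c2, c3, c4] [d1, d2, d3, d4])"
    and tr: "c1 + d2 = left_trace A (vector [l2 / D, - l1 / D])" "c3 + d4 = left_trace A (vector [- r2 / D, r1 / D])"
    "c1 + d3 = right_trace A (vector [l2 / D, - l1 / D])" "c2 + d4 = right_trace A (vector [- r2 / D, r1 / D])"
    by (rule msc_change_of_basis)
  have "c1 + d2 = (l1 * l2 - l2 * l1) / D" "c3 + d4 = (r1 * l2 - r2 * l1) / D" "c1 + d3 = (r1 * l2 - r2 * l1) / D" "c2 + d4 = (r2 * r1 - r1 * r2) / D"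
    unfolding tr A left_trace_msc right_trace_msc vector_2 defs[symmetric]
    by (simp_all add: diff_divide_distrib algebra_simps)
  then have "d2 = - c1" "c3 + d4 = 1" "c1 + d3 = 1" "d4 = - c2"
    using D by (simp_all add: eq_neg_iff_add_eq_0 add.commute flip: D_def)
  then have "d2 = - c1" "c3 = c2 + 1" "d3 = - c1 + 1" "d4 = - c2" by (simp_all add: algebra_simps)
  then show thesis using iso that by simp
qed

text \<open>The algebras whose right and left trace forms are \<open>\<rho>\<close> and \<open>\<mu>\<close> times the first coordinate.
  When \<open>\<rho>\<close> or \<open>\<mu>\<close> is nonzero, the line of \<open>e\<^sub>2\<close> is the common kernel of the traces, so only the
  base changes \<open>e\<^sub>1 \<mapsto> e\<^sub>1 + c e\<^sub>2\<close>, \<open>e\<^sub>2 \<mapsto> d e\<^sub>2\<close> remain.\<close>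

definition dependent_msc :: "'a::field \<Rightarrow> 'a \<Rightarrow> 'a \<Rightarrow> 'a \<Rightarrow> 'a \<Rightarrow> 'a \<Rightarrow> 'a^4^2" where
  "dependent_msc \<rho> \<mu> a1 a2 a4 b1 = msc [a1, a2, a2, a4] [b1, \<mu> - a1, \<rho> - a1, - a2]"

lemma normal_form_proportional_traces:
  fixes A :: "'a::field^4^2"
  assumes m: "m1 \<noteq> 0 \<or> m2 \<noteq> 0"
    and r: "\<And>x. right_trace A x = \<rho> * (m1 * x$1 + m2 * x$2)"
    and l: "\<And>x. left_trace A x = \<mu> * (m1 * x$1 + m2 * x$2)"
  obtains c1 c2 c4 d1 where "msc_isomorphic A (dependent_msc \<rho> \<mu> c1 c2 c4 d1)"
proof -
  \<comment> \<open>The common form shall be \<open>1\<close> on the first new vector and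
    \<open>0\<close> on the second. For \<open>m1 = 0\<close> the vectors are
    \<open>(0, 1 / m2)\<close> and \<open>(1, 0)\<close>, otherwise \<open>(1 / m1, 0)\<close> and
    \<open>(- m2, m1)\<close>.\<close>
  obtain p q s t where det: "p * t - s * q \<noteq> 0" and pq: "m1 * p + m2 * q = 1" "m1 * s + m2 * t = 0"
  proof (cases "m1 = 0")
    case True
    then show thesis using m that[of 0 0 1 "1 / m2"] by simp
  next
    case False
    then show thesis using that[of "1 / m1" m1 "- m2" 0] by simp
  qed
  obtain c1 c2 c3 c4 d1 d2 d3 d4 where iso: "msc_isomorphic A (msc [c1, c2, c3, c4] [d1, d2, d3, d4])"
    and tr: "c1 + d2 = left_trace A (vector [p, q])" "c3 + d4 = left_trace A (vector [s, t])"
      "c1 + d3 = right_trace A (vector [p, q])" "c2 + d4 = right_trace A (vector [s, t])"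
    using msc_change_of_basis[OF det] by blast
  have "c1 + d2 = \<mu>" "c3 + d4 = 0" "c1 + d3 = \<rho>" "c2 + d4 = 0"
    unfolding tr r l by (simp_all add: pq)
  then have "d2 = \<mu> - c1" "d4 = - c2" "d3 = \<rho> - c1" "c3 = c2"
    by (simp_all add: eq_diff_eq eq_neg_iff_add_eq_0 add.commute)
      (metis add_right_cancel)
  then show thesis using iso that[of c1 c2 c4 d1] by (simp add: dependent_msc_def)
qed

text \<open>The split is by the rank of the pair of trace forms. At rank one the right trace is
  normalized if it is nonzero, which leaves the ratio \<mu> as a parameter; only if it vanishes is
  the left trace normalized.\<close>

lemma trace_normal_form_cases:
  fixes A :: "'a::field^4^2"
  obtains (independent) c1 c2 c4 d1 where
      "msc_isomorphic A (msc [c1, c2, c2 + 1, c4] [d1, - c1, - c1 + 1, - c2])"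
  | (right) \<mu> c1 c2 c4 d1 where "msc_isomorphic A (dependent_msc 1 \<mu> c1 c2 c4 d1)"
  | (left) c1 c2 c4 d1 where "msc_isomorphic A (dependent_msc 0 1 c1 c2 c4 d1)"
  | (zero) c1 c2 c4 d1 where "A = dependent_msc 0 0 c1 c2 c4 d1"
proof -
  obtain a1 a2 a3 a4 b1 b2 b3 b4 where A: "A = msc [a1, a2, a3, a4] [b1, b2, b3, b4]"
    using msc_cases by blast
  define r1 r2 l1 l2 where "r1 = a1 + b3" "r2 = a2 + b4" "l1 = a1 + b2" "l2 = a3 + b4"
  note defs = this
  have R: "right_trace A x = r1 * x$1 + r2 * x$2" and L: "left_trace A x = l1 * x$1 + l2 * x$2" for x
    by (simp_all add: A right_trace_msc left_trace_msc defs)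
  consider "r1 * l2 - r2 * l1 \<noteq> 0" | "r1 * l2 = r2 * l1" "r1 \<noteq> 0" | "r1 * l2 = r2 * l1" "r1 = 0" "r2 \<noteq> 0"
    | "r1 = 0" "r2 = 0" "l1 \<noteq> 0 \<or> l2 \<noteq> 0" | "r1 = 0" "r2 = 0" "l1 = 0" "l2 = 0" by fastforce
  then show thesis
  proof cases
    case 1
    obtain c1 c2 c4 d1 where "msc_isomorphic A (msc [c1, c2, c2 + 1, c4] [d1, - c1, - c1 + 1, - c2])"
      by (rule normal_form_independent_traces[OF A 1[unfolded defs]])
    then show thesis by (rule independent)
  next
    case 2
    then have "l2 = l1 / r1 * r2" by (simp add: field_simps)
    then have L': "left_trace A x = l1 / r1 * (r1 * x$1 + r2 * x$2)" for x
      using 2 by (simp add: L algebra_simps)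
    have R': "right_trace A x = 1 * (r1 * x$1 + r2 * x$2)" for x by (simp add: R)
    have nz: "r1 \<noteq> 0 \<or> r2 \<noteq> 0" using 2 by blast
    obtain c1 c2 c4 d1 where "msc_isomorphic A (dependent_msc 1 (l1 / r1) c1 c2 c4 d1)"
      by (rule normal_form_proportional_traces[OF nz R' L'])
    then show thesis by (rule right)
  next
    case 3
    then have "l1 = 0" by simp
    then have L': "left_trace A x = l2 / r2 * (r1 * x$1 + r2 * x$2)" for x
      using 3 by (simp add: L algebra_simps)
    have R': "right_trace A x = 1 * (r1 * x$1 + r2 * x$2)" for x by (simp add: R)
    have nz: "r1 \<noteq> 0 \<or> r2 \<noteq> 0" using 3 by blast
    obtain c1 c2 c4 d1 where "msc_isomorphic A (dependent_msc 1 (l2 / r2) c1 c2 c4 d1)"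
      by (rule normal_form_proportional_traces[OF nz R' L'])
    then show thesis by (rule right)
  next
    case 4
    then have R': "right_trace A x = 0 * (l1 * x$1 + l2 * x$2)" and L': "left_trace A x = 1 * (l1 * x$1 + l2 * x$2)" for x
      by (simp_all add: R L)
    obtain c1 c2 c4 d1 where "msc_isomorphic A (dependent_msc 0 1 c1 c2 c4 d1)"
      by (rule normal_form_proportional_traces[OF 4(3) R' L'])
    then show thesis by (rule left)
  next
    case 5
    then have "b3 = - a1" "b4 = - a2" "b2 = - a1" "a3 = a2"
      by (simp_all add: defs eq_neg_iff_add_eq_0 add.commute) (metis add_right_cancel)
    then show thesis using zero[of a1 a2 a4 b1] A by (simp add: dependent_msc_def)
  qed
qed

text \<open>The new basis is \<open>f1 = e1 + c e2\<close>, \<open>f2 = d e2\<close>. The hypotheses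
  on \<open>a1'\<close> and \<open>b1'\<close> compare coordinates in
  \<open>f1 f1 = a1' f1 + b1' f2\<close>.\<close>

lemma dependent_msc_shear:
  fixes a1 :: "'a::field"
  assumes d: "d \<noteq> 0" and a: "a1' = a1 + 2 * c * a2 + c^2 * a4"
    and b: "d * b1' = b1 + c * (\<rho> + \<mu> - 2 * a1) - c^2 * a2 - c * a1'"
  shows "msc_isomorphic (dependent_msc \<rho> \<mu> a1 a2 a4 b1)
     (dependent_msc \<rho> \<mu> a1' (d * (a2 + c * a4)) (d^2 * a4) b1')"
\<comment> \<open>The map \<open>lin2 1 c 0 d\<close> turns new coordinates into old ones, so it
  goes from the second algebra to the first.\<close>
proof (rule algebra_isomorphic_sym, rule msc_isomorphicI[where p = 1 and q = c and s = 0 and t = d])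
  show "1 * d - 0 * c \<noteq> 0" using d by simp
  have b1: "b1 = d * b1' - c * (\<rho> + \<mu> - 2 * a1) + c^2 * a2 + c * a1'" using b by (simp add: algebra_simps)
  fix x y :: "'a^2"
  show "lin2 1 c 0 d (msc_mult (dependent_msc \<rho> \<mu> a1' (d * (a2 + c * a4)) (d^2 * a4) b1') x y) =
    msc_mult (dependent_msc \<rho> \<mu> a1 a2 a4 b1) (lin2 1 c 0 d x) (lin2 1 c 0 d y)"
    unfolding vec2_eq_iff lin2_nth dependent_msc_def msc_mult_nth b1 a
    by (simp add: algebra_simps power2_eq_square)
qed

text \<open>With both traces zero no line is singled out, so exchanging the basis vectors stays
  within the family.\<close>

lemma dependent_msc_0_0_swap:
  "msc_isomorphic (dependent_msc 0 0 a1 a2 a4 b1) (dependent_msc 0 0 (- a2) (- a1) b1 a4)"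
proof (rule msc_isomorphicI[where p = 0 and q = 1 and s = 1 and t = 0])
  show "0 * 0 - 1 * 1 \<noteq> (0::'a)" by simp
  fix x y :: "'a^2"
  show "lin2 0 1 1 0 (msc_mult (dependent_msc 0 0 a1 a2 a4 b1) x y) =
    msc_mult (dependent_msc 0 0 (- a2) (- a1) b1 a4) (lin2 0 1 1 0 x) (lin2 0 1 1 0 y)"
    unfolding vec2_eq_iff lin2_nth dependent_msc_def msc_mult_nth by (simp add: algebra_simps)
qed

text \<open>With both traces zero nothing fixes the length of the first basis vector, which may be
  multiplied by \<open>k\<close>.\<close>

lemma dependent_msc_0_0_scale:
  fixes a1 :: "'a::field"
  assumes "k \<noteq> 0"
  shows "msc_isomorphic (dependent_msc 0 0 a1 a2 0 b1) (dependent_msc 0 0 (k * a1) a2 0 (k^2 * b1))"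
proof (rule algebra_isomorphic_sym, rule msc_isomorphicI[where p = k and q = 0 and s = 0 and t = 1])
  show "k * 1 - 0 * 0 \<noteq> 0" using assms by simp
  fix x y :: "'a^2"
  show "lin2 k 0 0 1 (msc_mult (dependent_msc 0 0 (k * a1) a2 0 (k^2 * b1)) x y) =
    msc_mult (dependent_msc 0 0 a1 a2 0 b1) (lin2 k 0 0 1 x) (lin2 k 0 0 1 y)"
    unfolding vec2_eq_iff lin2_nth dependent_msc_def msc_mult_nth
    by (simp add: algebra_simps power2_eq_square)
qed

text \<open>The second basis vector spans an ideal.\<close>

lemma dependent_msc_has_ideal:
  "\<not> has_ideals (dependent_msc \<rho> \<mu> a1 0 0 b1) 0"
  by (simp add: dependent_msc_def has_ideals_iff Let_def)

lemma has_ideals_0_isomorphic: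
  "msc_isomorphic A B \<Longrightarrow> has_ideals A 0 \<Longrightarrow> has_ideals B 0"
  using algebra_isomorphic_nontrivial_ideals_empty by (simp add: has_ideals_def) fastforce

section \<open>Reduction of simple algebras by means of roots\<close>

lemma sqrt_exists:
  fixes a :: "'a::field"
  assumes roots: "\<And>p :: 'a poly. degree p = 2 \<or> degree p = 3 \<Longrightarrow> \<exists>x. poly p x = 0"
  obtains x where "x^2 = a"
proof -
  obtain x where "poly [:- a, 0, 1:] x = 0" using roots[of "[:- a, 0, 1:]"] by auto
  then show thesis using that[of x] by (simp add: power2_eq_square eq_neg_iff_add_eq_0)
qed

text \<open>If \<open>a4\<close> is nonzero, the shear by \<open>- a2 / a4\<close> removes
  \<open>a2\<close> and a square root of \<open>1 / a4\<close> rescales \<open>a4\<close> to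
  \<open>1\<close>. If \<open>a4 = 0\<close>, simplicity makes \<open>a2\<close> nonzero and
  rescaling the second basis vector turns it into \<open>1\<close>.\<close>

lemma simple_dependent_msc_cases:
  fixes a1 :: "'a::field"
  assumes roots: "\<And>p :: 'a poly. degree p = 2 \<or> degree p = 3 \<Longrightarrow> \<exists>x. poly p x = 0"
    and simple: "has_ideals (dependent_msc \<rho> \<mu> a1 a2 a4 b1) 0"
  obtains c1 d1 where "a4 \<noteq> 0" "msc_isomorphic (dependent_msc \<rho> \<mu> a1 a2 a4 b1) (dependent_msc \<rho> \<mu> c1 0 1 d1)"
  | d1 where "a4 = 0" "msc_isomorphic (dependent_msc \<rho> \<mu> a1 a2 a4 b1) (dependent_msc \<rho> \<mu> a1 1 0 d1)"
proof (cases "a4 = 0")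
  case False
  obtain d where d: "d^2 = 1 / a4" using sqrt_exists[OF roots] by blast
  then have "d \<noteq> 0" using False by auto
  define c where "c = - a2 / a4"
  have "d * (a2 + c * a4) = 0" "d^2 * a4 = 1" using False d by (simp_all add: c_def)
  moreover have "d * ((b1 + c * (\<rho> + \<mu> - 2 * a1) - c^2 * a2 - c * (a1 + 2 * c * a2 + c^2 * a4)) / d) =
    b1 + c * (\<rho> + \<mu> - 2 * a1) - c^2 * a2 - c * (a1 + 2 * c * a2 + c^2 * a4)" using \<open>d \<noteq> 0\<close> by simp
  ultimately show thesis using dependent_msc_shear[OF \<open>d \<noteq> 0\<close> refl] that(1)[OF False] by metis
next
  case True
  then have "a2 \<noteq> 0" using simple dependent_msc_has_ideal by metis
  then show thesis
    using dependent_msc_shear[of "1 / a2" a1 a1 0 a2 a4 "a2 * b1" b1 \<rho> \<mu>] that(2) True by simp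
qed

lemma dependent_msc_0_0_root:
  fixes a1 :: "'a::field"
  assumes roots: "\<And>p :: 'a poly. degree p = 2 \<or> degree p = 3 \<Longrightarrow> \<exists>x. poly p x = 0"
  obtains c1 c2 d1 where "msc_isomorphic (dependent_msc 0 0 a1 a2 a4 b1) (dependent_msc 0 0 c1 c2 0 d1)"
proof (cases "a4 = 0")
  case True
  then show thesis using that algebra_isomorphic_refl by metis
next
  case False
  \<comment> \<open>The cubic is \<open>det(x, x x)\<close> at \<open>x = e\<^sub>1 + c e\<^sub>2\<close>, so a root makes \<open>x x\<close> a multiple of \<open>x\<close>.\<close>
  then obtain c where c: "poly [:b1, - 3 * a1, - 3 * a2, - a4:] c = 0"
    using roots[of "[:b1, - 3 * a1, - 3 * a2, - a4:]"] by auto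
  have "b1 + c * (0 + 0 - 2 * a1) - c^2 * a2 - c * (a1 + 2 * c * a2 + c^2 * a4) =
      poly [:b1, - 3 * a1, - 3 * a2, - a4:] c" by (simp add: algebra_simps power2_eq_square)
  also note c
  finally have "1 * 0 = b1 + c * (0 + 0 - 2 * a1) - c^2 * a2 - c * (a1 + 2 * c * a2 + c^2 * a4)" by simp
  then have "msc_isomorphic (dependent_msc 0 0 a1 a2 a4 b1)
    (dependent_msc 0 0 (a1 + 2 * c * a2 + c^2 * a4) (1 * (a2 + c * a4)) (1^2 * a4) 0)"
    by (intro dependent_msc_shear) simp_all
  \<comment> \<open>The shear has made \<open>b1\<close> vanish; the swap moves this zero to the
    place of \<open>a4\<close>.\<close>
  then show thesis using that dependent_msc_0_0_swap algebra_isomorphic_trans by metis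
qed

section \<open>Separating the normal forms\<close>

text \<open>The rank of the pair of trace forms is an invariant: it is two on the left and at most
  one on the right.\<close>

lemma independent_not_isomorphic_dependent:
  "\<not> msc_isomorphic (msc [a1, a2, a2 + 1, a4] [b1, - a1, - a1 + 1, - a2])
     (dependent_msc \<rho> \<mu> c1 c2 c4 (d1 :: 'a::field))"
proof
  assume "msc_isomorphic (msc [a1, a2, a2 + 1, a4] [b1, - a1, - a1 + 1, - a2])
     (dependent_msc \<rho> \<mu> c1 c2 c4 d1)"
  then have iso: "msc_isomorphic (msc [a1, a2, a2 + 1, a4] [b1, - a1, - a1 + 1, - a2])
     (msc [c1, c2, c2, c4] [d1, \<mu> - c1, \<rho> - c1, - c2])" by (simp only: dependent_msc_def)
  show False
  proof (rule msc_isomorphic_coordinates[OF iso])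
    fix p q s t
    assume "a2 + 1 + - a2 = (c1 + (\<mu> - c1)) * s + (c2 + - c2) * t"
      "a1 + (- a1 + 1) = (c1 + (\<rho> - c1)) * p + (c2 + - c2) * q"
      "a2 + - a2 = (c1 + (\<rho> - c1)) * s + (c2 + - c2) * t"
    then have "1 = \<mu> * s" "1 = \<rho> * p" "0 = \<rho> * s" by simp_all
    then show False by auto
  qed
qed

text \<open>On both sides the trace forms are the coordinate functions, so the isomorphism is the
  identity.\<close>

lemma independent_isomorphic_unique:
  fixes a1 :: "'a::field"
  assumes iso: "msc_isomorphic (msc [a1, a2, a2 + 1, a4] [b1, - a1, - a1 + 1, - a2])
     (msc [c1, c2, c2 + 1, c4] [d1, - c1, - c1 + 1, - c2])"
  shows "a1 = c1 \<and> a2 = c2 \<and> a4 = c4 \<and> b1 = d1"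
proof (rule msc_isomorphic_coordinates[OF iso])
  fix p q s t
  assume "a1 + - a1 = (c1 + - c1) * p + (c2 + 1 + - c2) * q"
    "a2 + 1 + - a2 = (c1 + - c1) * s + (c2 + 1 + - c2) * t"
    "a1 + (- a1 + 1) = (c1 + (- c1 + 1)) * p + (c2 + - c2) * q"
    "a2 + - a2 = (c1 + (- c1 + 1)) * s + (c2 + - c2) * t"
  then have *: "p = 1" "q = 0" "s = 0" "t = 1" by simp_all
  assume "a1 * p + b1 * s = c1 * (p * p) + c2 * (p * q) + (c2 + 1) * (q * p) + c4 * (q * q)"
    "a1 * q + b1 * t = d1 * (p * p) + - c1 * (p * q) + (- c1 + 1) * (q * p) + - c2 * (q * q)"
    "a2 * p + - a1 * s = c1 * (p * s) + c2 * (p * t) + (c2 + 1) * (q * s) + c4 * (q * t)"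
    "a4 * p + - a2 * s = c1 * (s * s) + c2 * (s * t) + (c2 + 1) * (t * s) + c4 * (t * t)"
  then show ?thesis unfolding * by simp
qed

lemma dependent_isomorphic_0_0:
  fixes a1 :: "'a::field"
  assumes "msc_isomorphic (dependent_msc \<rho> \<mu> a1 a2 a4 b1) (dependent_msc 0 0 c1 c2 c4 d1)"
  shows "\<rho> = 0 \<and> \<mu> = 0"
proof -
  have iso: "msc_isomorphic (msc [a1, a2, a2, a4] [b1, \<mu> - a1, \<rho> - a1, - a2])
     (msc [c1, c2, c2, c4] [d1, 0 - c1, 0 - c1, - c2])" using assms by (simp only: dependent_msc_def)
  show ?thesis
  proof (rule msc_isomorphic_coordinates[OF iso])
    fix p q s t
    assume "a1 + (\<mu> - a1) = (c1 + (0 - c1)) * p + (c2 + - c2) * q"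
      "a1 + (\<rho> - a1) = (c1 + (0 - c1)) * p + (c2 + - c2) * q"
    then show ?thesis by simp
  qed
qed

text \<open>One representative for each point \<open>(\<rho> : \<mu>)\<close> of the projective
  line, since rescaling the first basis vector multiplies both by a common factor.\<close>

definition normalized_trace :: "'a::field \<Rightarrow> 'a \<Rightarrow> bool" where
  "normalized_trace \<rho> \<mu> \<longleftrightarrow> \<rho> = 1 \<or> \<rho> = 0 \<and> \<mu> = 1"

text \<open>An isomorphism preserves the common kernel of the traces, whence \<open>s = 0\<close>,
  and their normalization, whence \<open>p = 1\<close>; it is therefore a shear combined with a
  rescaling of the second basis vector.\<close>

lemma dependent_isomorphic_shear:
  fixes a1 :: "'a::field"
  assumes iso: "msc_isomorphic (dependent_msc \<rho> \<mu> a1 a2 a4 b1) (dependent_msc \<rho>' \<mu>' c1 c2 c4 d1)"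
    and n: "normalized_trace \<rho> \<mu>" and n': "normalized_trace \<rho>' \<mu>'"
  obtains q t where "t \<noteq> 0" "\<rho> = \<rho>'" "\<mu> = \<mu>'" "a1 = c1 + 2 * q * c2 + q^2 * c4"
    "a2 = t * (c2 + q * c4)" "a4 = t^2 * c4"
    "a1 * q + b1 * t = d1 + q * (\<rho>' + \<mu>' - 2 * c1) - q^2 * c2"
proof -
  have iso: "msc_isomorphic (msc [a1, a2, a2, a4] [b1, \<mu> - a1, \<rho> - a1, - a2])
     (msc [c1, c2, c2, c4] [d1, \<mu>' - c1, \<rho>' - c1, - c2])" using iso by (simp only: dependent_msc_def)
  show thesis
  proof (rule msc_isomorphic_coordinates[OF iso])
    fix p q s t
    assume "a1 + (\<mu> - a1) = (c1 + (\<mu>' - c1)) * p + (c2 + - c2) * q"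
      "a2 + - a2 = (c1 + (\<mu>' - c1)) * s + (c2 + - c2) * t"
      "a1 + (\<rho> - a1) = (c1 + (\<rho>' - c1)) * p + (c2 + - c2) * q"
      "a2 + - a2 = (c1 + (\<rho>' - c1)) * s + (c2 + - c2) * t"
    then have tr: "\<mu> = \<mu>' * p" "\<mu>' * s = 0" "\<rho> = \<rho>' * p" "\<rho>' * s = 0" by simp_all
    then have "s = 0" using n' by (auto simp: normalized_trace_def)
    moreover have "p = 1" using n n' tr(1,3) by (auto simp: normalized_trace_def)
    moreover assume "s \<noteq> 0 \<or> t \<noteq> 0"
    ultimately have st: "s = 0" "t \<noteq> 0" "p = 1" by simp_all
    assume e: "a1 * p + b1 * s = c1 * (p * p) + c2 * (p * q) + c2 * (q * p) + c4 * (q * q)"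
      "a1 * q + b1 * t = d1 * (p * p) + (\<mu>' - c1) * (p * q) + (\<rho>' - c1) * (q * p) + - c2 * (q * q)"
      "a2 * p + (\<mu> - a1) * s = c1 * (p * s) + c2 * (p * t) + c2 * (q * s) + c4 * (q * t)"
      "a4 * p + - a2 * s = c1 * (s * s) + c2 * (s * t) + c2 * (t * s) + c4 * (t * t)"
    show thesis
    proof (rule that[OF st(2)])
      show "\<rho> = \<rho>'" "\<mu> = \<mu>'" using tr st by simp_all
      show "a1 = c1 + 2 * q * c2 + q^2 * c4" "a2 = t * (c2 + q * c4)" "a4 = t^2 * c4"
        "a1 * q + b1 * t = d1 + q * (\<rho>' + \<mu>' - 2 * c1) - q^2 * c2"
        using e(1) e(3) e(4) unfolding e(2) st by (simp_all add: power2_eq_square algebra_simps)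
    qed
  qed
qed

text \<open>For \<open>(a2, a4) = (0, 1)\<close> the shear is trivial and the scale satisfies
  \<open>t^2 = 1\<close>, leaving a sign in \<open>b1\<close>. For \<open>(1, 0)\<close> the scale
  is \<open>1\<close> but the shear \<open>q\<close> stays free; each characteristic settles it by
  its own normalization.\<close>

lemma dependent_isomorphic_unique:
  fixes a1 :: "'a::field"
  assumes iso: "msc_isomorphic (dependent_msc \<rho> \<mu> a1 a2 a4 b1) (dependent_msc \<rho>' \<mu>' c1 c2 c4 d1)"
    and n: "normalized_trace \<rho> \<mu>" "normalized_trace \<rho>' \<mu>'"
    and A: "(a2, a4) \<in> {(0, 1), (1, 0)}" "(c2, c4) \<in> {(0, 1), (1, 0)}"
  shows "\<rho> = \<rho>' \<and> \<mu> = \<mu>' \<and> a2 = c2 \<and> a4 = c4 \<and> (a4 = 1 \<longrightarrow> a1 = c1 \<and> (d1 = b1 \<or> d1 = - b1)) \<and>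
    (a4 = 0 \<longrightarrow> (\<exists>q. a1 = c1 + 2 * q \<and> a1 * q + b1 = d1 + q * (\<rho> + \<mu> - 2 * c1) - q^2))"
  using iso n
proof (rule dependent_isomorphic_shear)
  fix q t
  assume t: "t \<noteq> 0" and tr: "\<rho> = \<rho>'" "\<mu> = \<mu>'" and e: "a1 = c1 + 2 * q * c2 + q^2 * c4"
    "a2 = t * (c2 + q * c4)" "a4 = t^2 * c4"
    "a1 * q + b1 * t = d1 + q * (\<rho>' + \<mu>' - 2 * c1) - q^2 * c2"
  show ?thesis
  proof (cases "c4 = 0")
    case True
    then have "c2 = 1" "a4 = 0" "a2 = 1" using A e(3) by auto
    moreover from this have "t = 1" using e(2) True by simp
    ultimately show ?thesis using tr e(1,4) True by auto
  next
    case False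
    then have "c4 = 1" "c2 = 0" using A(2) by auto
    moreover from this have "a4 = 1" "a2 = 0" using e(3) t A(1) by auto
    moreover from calculation have "q = 0" "t^2 = 1" using e(2,3) t by simp_all
    moreover from calculation have "t = 1 \<or> t = -1" by (simp add: power2_eq_1_iff)
    ultimately show ?thesis using tr e(1,4) by auto
  qed
qed

lemma has_ideals_0_iff: "has_ideals A n \<Longrightarrow> has_ideals A 0 \<longleftrightarrow> n = 0"
  by (auto simp: has_ideals_def)

section \<open>Classification in characteristic 2\<close>

text \<open>In characteristic 2 the last entry \<open>1\<close> of \<open>A3_2\<close> is the
  \<open>- a2\<close> that the common form demands.\<close>

lemma msc2_dependent:
  assumes c: "CHAR('a::field) = 2"
  shows "msc2 (A2_2 a1 b1 b2 :: 'a family2) = dependent_msc 1 (a1 + b2) a1 0 1 b1"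
    "msc2 (A3_2 a1 b2 :: 'a family2) = dependent_msc 1 (a1 + b2) a1 1 0 0"
    "msc2 (A6_2 a1 b1 :: 'a family2) = dependent_msc 0 1 a1 0 1 b1"
    "msc2 (A7_2 a1 :: 'a family2) = dependent_msc 0 1 a1 1 0 0"
    "msc2 (A11_2 :: 'a family2) = dependent_msc 0 0 1 1 0 0"
  by (simp_all add: dependent_msc_def CHAR_2_simps(2)[OF c, of 1])

lemma has_ideals_A1_2:
  fixes a1 :: "'a::field"
  assumes c: "CHAR('a) = 2"
  shows "has_ideals (msc2 (A1_2 a1 a2 a4 b1)) (if a4 = a1 \<and> b1 = a2 then 1 else 0)"
proof -
  have *: "- a1 - 2 * a2 = a1" "2 * a1 + a2 = a2" by (simp_all add: CHAR_2_simps(1,2)[OF c])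
  show ?thesis
    unfolding msc2.simps
    using has_ideals_A1_0[of a4 a1 a2 b1, unfolded *] has_ideals_A1_1[of a4 a1 a2 b1, unfolded *]
    by (simp split: if_split)
qed

text \<open>Since the absence of ideals is invariant, this puts any canonical form of a simple
  algebra into the list.\<close>

lemma no_ideal_list2_iff:
  assumes c: "CHAR('a::field) = 2"
  shows "(F :: 'a family2) \<in> no_ideal_list2 \<longleftrightarrow> has_ideals (msc2 F) 0"
proof (cases F)
  case (A1_2 a1 a2 a4 b1)
  then show ?thesis
    using has_ideals_0_iff[OF has_ideals_A1_2[OF c, of a1 a2 a4 b1]] by (auto simp: no_ideal_list2_def)
next
  case (A2_2 a1 b1 b2)
  then show ?thesis
    using has_ideals_0_iff[OF has_ideals_A2_2[OF c, of a1 b1 b2]] by (auto simp: no_ideal_list2_def)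
next
  case (A3_2 a1 b2)
  then show ?thesis
    using has_ideals_0_iff[OF has_ideals_A3_2[OF c, of a1 b2]] by (auto simp: no_ideal_list2_def)
next
  case (A4_2 a1 b2)
  then show ?thesis
    using has_ideals_0_iff[OF has_ideals_A4[of a1 b2]] by (auto simp: no_ideal_list2_def)
next
  case (A5_2 a1)
  then show ?thesis
    using has_ideals_0_iff[OF has_ideals_A5_2[of a1]] by (auto simp: no_ideal_list2_def)
next
  case (A6_2 a1 b1)
  then show ?thesis using has_ideals_A6 by (simp add: no_ideal_list2_def)
next
  case (A7_2 a1)
  then show ?thesis using has_ideals_A7_2[of a1] by (simp add: no_ideal_list2_def)
next
  case (A8_2 a1)
  then show ?thesis
    using has_ideals_0_iff[OF has_ideals_A8[of a1]] by (auto simp: no_ideal_list2_def)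
next
  case A9_2
  then show ?thesis
    using has_ideals_0_iff[OF has_ideals_A9_2[where 'a='a]] by (auto simp: no_ideal_list2_def)
next
  case A10_2
  then show ?thesis
    using has_ideals_0_iff[OF has_ideals_A10[where 'a='a]] by (auto simp: no_ideal_list2_def)
next
  case A11_2
  then show ?thesis using has_ideals_A11_2[OF c] by (simp add: no_ideal_list2_def)
next
  case A12_2
  then show ?thesis
    using has_ideals_0_iff[OF has_ideals_A12[where 'a='a]] by (auto simp: no_ideal_list2_def)
qed

text \<open>As \<open>2 = 0\<close>, this shear fixes \<open>a1\<close>, and the new
  \<open>b1\<close> is a quadratic polynomial in the shear parameter; a root makes it
  vanish.\<close>

lemma dependent_msc_shear_2:
  fixes a1 :: "'a::field"
  assumes roots: "\<And>p :: 'a poly. degree p = 2 \<or> degree p = 3 \<Longrightarrow> \<exists>x. poly p x = 0"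
    and c: "CHAR('a) = 2"
  shows "msc_isomorphic (dependent_msc \<rho> \<mu> a1 1 0 b1) (dependent_msc \<rho> \<mu> a1 1 0 0)"
proof -
  obtain x where x: "poly [:b1, \<rho> + \<mu> - 3 * a1, -1:] x = 0"
    using roots[of "[:b1, \<rho> + \<mu> - 3 * a1, -1:]"] by auto
  have a1: "a1 = a1 + 2 * x * 1 + x^2 * 0" by (simp add: CHAR_2_simps(1)[OF c])
  have "b1 + x * (\<rho> + \<mu> - 2 * a1) - x^2 * 1 - x * a1 = poly [:b1, \<rho> + \<mu> - 3 * a1, -1:] x"
    by (simp add: algebra_simps power2_eq_square)
  then have "1 * 0 = b1 + x * (\<rho> + \<mu> - 2 * a1) - x^2 * 1 - x * a1" by (simp only: x mult_zero_right)
  from dependent_msc_shear[OF one_neq_zero a1 this] show ?thesis by simp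
qed

lemma simple_msc2_exists:
  fixes A :: "'a::field^4^2"
  assumes roots: "\<And>p :: 'a poly. degree p = 2 \<or> degree p = 3 \<Longrightarrow> \<exists>x. poly p x = 0"
    and c: "CHAR('a) = 2" and simple: "has_ideals A 0"
  shows "\<exists>F. msc_isomorphic A (msc2 F)"
proof (cases A rule: trace_normal_form_cases)
  case (independent c1 c2 c4 d1)
  then have "msc_isomorphic A (msc2 (A1_2 c1 c2 c4 d1))" by simp
  then show ?thesis by blast
next
  case (right \<mu> c1 c2 c4 d1)
  show ?thesis
  proof (rule simple_dependent_msc_cases[OF roots has_ideals_0_isomorphic[OF right simple]])
    fix c1' d1'
    assume "msc_isomorphic (dependent_msc 1 \<mu> c1 c2 c4 d1) (dependent_msc 1 \<mu> c1' 0 1 d1')"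
    then have "msc_isomorphic A (msc2 (A2_2 c1' d1' (\<mu> - c1')))"
      using algebra_isomorphic_trans[OF right] by (simp only: msc2_dependent[OF c] add_diff_cancel_left' diff_add_cancel add_diff_eq)
    then show ?thesis by blast
  next
    fix d1'
    assume "msc_isomorphic (dependent_msc 1 \<mu> c1 c2 c4 d1) (dependent_msc 1 \<mu> c1 1 0 d1')"
    then have "msc_isomorphic A (msc2 (A3_2 c1 (\<mu> - c1)))"
      using algebra_isomorphic_trans[OF algebra_isomorphic_trans[OF right] dependent_msc_shear_2[OF roots c]]
      by (simp only: msc2_dependent[OF c] add_diff_cancel_left' diff_add_cancel add_diff_eq)
    then show ?thesis by blast
  qed
next
  case (left c1 c2 c4 d1)
  show ?thesis
  proof (rule simple_dependent_msc_cases[OF roots has_ideals_0_isomorphic[OF left simple]])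
    fix c1' d1'
    assume "msc_isomorphic (dependent_msc 0 1 c1 c2 c4 d1) (dependent_msc 0 1 c1' 0 1 d1')"
    then have "msc_isomorphic A (msc2 (A6_2 c1' d1'))"
      using algebra_isomorphic_trans[OF left] by (simp only: msc2_dependent[OF c])
    then show ?thesis by blast
  next
    fix d1'
    assume "msc_isomorphic (dependent_msc 0 1 c1 c2 c4 d1) (dependent_msc 0 1 c1 1 0 d1')"
    then have "msc_isomorphic A (msc2 (A7_2 c1))"
      using algebra_isomorphic_trans[OF algebra_isomorphic_trans[OF left] dependent_msc_shear_2[OF roots c]]
      by (simp only: msc2_dependent[OF c])
    then show ?thesis by blast
  qed
next
  case (zero c1 c2 c4 d1)
  obtain a1 a2 b1 where 1: "msc_isomorphic A (dependent_msc 0 0 a1 a2 0 b1)"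
    unfolding zero by (rule dependent_msc_0_0_root[OF roots])
  show ?thesis
  \<comment> \<open>The entry in the place of \<open>a4\<close> is already \<open>0\<close>, so only
    the second alternative can occur.\<close>
  proof (rule simple_dependent_msc_cases[OF roots has_ideals_0_isomorphic[OF 1 simple]])
    fix d1'
    assume "msc_isomorphic (dependent_msc 0 0 a1 a2 0 b1) (dependent_msc 0 0 a1 1 0 d1')"
    then have 2: "msc_isomorphic A (dependent_msc 0 0 a1 1 0 0)"
      using algebra_isomorphic_trans[OF algebra_isomorphic_trans[OF 1] dependent_msc_shear_2[OF roots c]] by blast
    \<comment> \<open>For \<open>a1 = 0\<close> the algebra would be \<open>A10_2\<close>, which has
      an ideal; a nonzero \<open>a1\<close> is scaled to \<open>1\<close>.\<close>
    have "a1 \<noteq> 0"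
    proof
      assume "a1 = 0"
      then have "dependent_msc 0 0 a1 1 0 0 = msc2 A10_2" by (simp add: dependent_msc_def)
      then show False
        using has_ideals_0_isomorphic[OF 2 simple] has_ideals_0_iff[OF has_ideals_A10[where 'a='a]] by simp
    qed
    then have "msc_isomorphic (dependent_msc 0 0 a1 1 0 0) (msc2 A11_2)"
      using dependent_msc_0_0_scale[of "1 / a1" a1 1 0] by (simp add: msc2_dependent[OF c] del: msc2.simps)
    then show ?thesis using algebra_isomorphic_trans[OF 2] by blast
  qed simp_all
qed

text \<open>The four families with proportional, not both zero traces are merged into one case from
  whose parameters \<open>F\<close> can be recovered, so uniqueness compares three cases instead of
  six.\<close>

lemma no_ideal_list2_cases:
  assumes c: "CHAR('a::field) = 2" and F: "(F :: 'a family2) \<in> no_ideal_list2"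
  obtains (independent) a1 a2 a4 b1 where "F = A1_2 a1 a2 a4 b1"
    "msc2 F = msc [a1, a2, a2 + 1, a4] [b1, - a1, - a1 + 1, - a2]"
  | (dependent) \<rho> \<mu> a1 a2 a4 b1 where "msc2 F = dependent_msc \<rho> \<mu> a1 a2 a4 b1" "normalized_trace \<rho> \<mu>"
      "(a2, a4) \<in> {(0, 1), (1, 0)}" "a4 = 0 \<longrightarrow> b1 = 0"
      "F = (if \<rho> = 1 then if a4 = 1 then A2_2 a1 b1 (\<mu> - a1) else A3_2 a1 (\<mu> - a1)
            else if a4 = 1 then A6_2 a1 b1 else A7_2 a1)"
  | (zero) "F = A11_2" "msc2 F = dependent_msc 0 0 1 1 0 0"
proof (cases F)
  case (A1_2 a1 a2 a4 b1)
  then show thesis by (intro independent) simp_all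
next
  case (A2_2 a1 b1 b2)
  then show thesis
    by (intro dependent[of 1 "a1 + b2" a1 0 1 b1]) (simp_all add: msc2_dependent[OF c] normalized_trace_def del: msc2.simps)
next
  case (A3_2 a1 b2)
  then show thesis
    by (intro dependent[of 1 "a1 + b2" a1 1 0 0]) (simp_all add: msc2_dependent[OF c] normalized_trace_def del: msc2.simps)
next
  case (A6_2 a1 b1)
  then show thesis
    by (intro dependent[of 0 1 a1 0 1 b1]) (simp_all add: msc2_dependent[OF c] normalized_trace_def del: msc2.simps)
next
  case (A7_2 a1)
  then show thesis
    by (intro dependent[of 0 1 a1 1 0 0]) (simp_all add: msc2_dependent[OF c] normalized_trace_def del: msc2.simps)
next
  case A11_2
  then show thesis by (intro zero) (simp_all add: msc2_dependent[OF c] del: msc2.simps)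
qed (use F in \<open>auto simp: no_ideal_list2_def\<close>)

lemma not_normalized_trace_0_0: "\<not> normalized_trace (0::'a::field) 0"
  by (simp add: normalized_trace_def)

lemma no_ideal_list2_unique:
  assumes c: "CHAR('a::field) = 2"
    and F: "(F :: 'a family2) \<in> no_ideal_list2" and G: "G \<in> no_ideal_list2"
    and iso: "msc_isomorphic (msc2 F) (msc2 G)"
  shows "F = G"
  using c F
proof (cases rule: no_ideal_list2_cases)
  case Fi: (independent a1 a2 a4 b1)
  from c G show ?thesis
  proof (cases rule: no_ideal_list2_cases)
    case (independent c1 c2 c4 d1)
    then show ?thesis
      using independent_isomorphic_unique[of a1 a2 a4 b1 c1 c2 c4 d1] iso Fi by metis
  qed (use iso Fi independent_not_isomorphic_dependent in metis)+
next
  case Fd: (dependent \<rho> \<mu> a1 a2 a4 b1)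
  from c G show ?thesis
  proof (cases rule: no_ideal_list2_cases)
    case (independent c1 c2 c4 d1)
    then show ?thesis
      using algebra_isomorphic_sym[OF iso] Fd(1) independent_not_isomorphic_dependent by metis
  next
    case Gd: (dependent \<rho>' \<mu>' c1 c2 c4 d1)
    have u: "\<rho> = \<rho>' \<and> \<mu> = \<mu>' \<and> a2 = c2 \<and> a4 = c4 \<and> (a4 = 1 \<longrightarrow> a1 = c1 \<and> (d1 = b1 \<or> d1 = - b1)) \<and>
      (a4 = 0 \<longrightarrow> (\<exists>q. a1 = c1 + 2 * q \<and> a1 * q + b1 = d1 + q * (\<rho> + \<mu> - 2 * c1) - q^2))"
      using iso Fd(1-3) Gd(1-3) by (intro dependent_isomorphic_unique) metis+
    have "a4 = 0 \<or> a4 = 1" using Fd(3) by auto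
    \<comment> \<open>For \<open>a4 = 1\<close> the sign of \<open>b1\<close> is immaterial in
      characteristic 2; for \<open>a4 = 0\<close> the shift \<open>2 * q\<close> is zero and
      \<open>b1\<close> and \<open>d1\<close> are normalized to \<open>0\<close>.\<close>
    then have "a1 = c1 \<and> b1 = d1"
      using u Fd(4) Gd(4) by (auto simp: CHAR_2_simps(1,2)[OF c])
    then show ?thesis unfolding Fd(5) Gd(5) using u by simp
  next
    case zero
    then show ?thesis
      using dependent_isomorphic_0_0 iso Fd(1,2) not_normalized_trace_0_0 by metis
  qed
next
  case Fz: zero
  from c G show ?thesis
  proof (cases rule: no_ideal_list2_cases)
    case (independent c1 c2 c4 d1)
    then show ?thesis
      using algebra_isomorphic_sym[OF iso] Fz(2) independent_not_isomorphic_dependent by metis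
  next
    case (dependent \<rho>' \<mu>' c1 c2 c4 d1)
    then show ?thesis
      using dependent_isomorphic_0_0 algebra_isomorphic_sym[OF iso] Fz(2) not_normalized_trace_0_0 by metis
  next
    case zero
    with Fz show ?thesis by simp
  qed
qed

section \<open>From abstract simple algebras to matrices\<close>

lemma simple_algebra_isomorphic_msc:
  assumes "simple_two_dim_algebra (scl :: 'a::field \<Rightarrow> 'v::ab_group_add \<Rightarrow> 'v) mul"
  obtains A where "algebra_isomorphic scl mul (*s) (msc_mult A)" "has_ideals A 0"
proof -
  obtain A where A: "algebra_isomorphic scl mul (*s) (msc_mult A)"
    using assms two_dim_algebra_isomorphic_msc unfolding simple_two_dim_algebra_def by blast
  moreover have "msc_ideals A = {}"
    using algebra_isomorphic_nontrivial_ideals_empty[OF A] assms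
    unfolding simple_two_dim_algebra_def by blast
  ultimately show thesis using that msc_ideals_empty_iff by blast
qed

section \<open>Classification in characteristic 3\<close>

lemma msc3_dependent:
  "msc3 (A2_3 a1 b1 b2 :: 'a::field family3) = dependent_msc 1 (a1 + b2) a1 0 1 b1"
  "msc3 (A3_3 b1 b2 :: 'a::field family3) = dependent_msc 1 b2 0 1 0 b1"
  "msc3 (A6_3 a1 b1 :: 'a::field family3) = dependent_msc 0 1 a1 0 1 b1"
  "msc3 (A7_3 b1 :: 'a::field family3) = dependent_msc 0 1 0 1 0 b1"
  "msc3 (A9_3 :: 'a::field family3) = dependent_msc 0 0 0 1 0 1"
  by (simp_all add: dependent_msc_def)

text \<open>The root \<open>i\<close> supplies the two ideals of \<open>A2_3\<close> at
  \<open>a1 = b2 = 1/2\<close>, \<open>b1 = 0\<close>.\<close>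

lemma no_ideal_list3_iff:
  assumes c: "CHAR('a::field) = 3" and i: "i^2 = (-1::'a)"
  shows "(F :: 'a family3) \<in> no_ideal_list3 \<longleftrightarrow> has_ideals (msc3 F) 0"
proof (cases F)
  case (A1_3 a1 a2 a4 b1)
  then show ?thesis
    using has_ideals_A1_0[of a4 a1 a2 b1] has_ideals_0_iff[OF has_ideals_A1_1[of a4 a1 a2 b1]]
    by (auto simp: no_ideal_list3_def)
next
  case (A2_3 a1 b1 b2)
  \<comment> \<open>These cases are exhaustive because \<open>a1 = 1/2\<close> and
    \<open>b2 = 1 - a1\<close> together mean \<open>b2 = 1/2\<close>.\<close>
  consider "(a1 = 1 \<and> b1 \<noteq> 0 \<and> b2 = 0) \<or>
         (a1 \<noteq> 1/2 \<and> a1 \<noteq> 1 \<and> b1^2 + (a1 - 1) * (2 * a1 - 1)^2 \<noteq> 0 \<and> b2 = 1 - a1) \<or>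
         (a1 = 1/2 \<and> b2 = 1/2 \<and> b1 \<noteq> 0) \<or> b2 \<noteq> 1 - a1"
    | "(a1 = 1 \<and> b1 = 0 \<and> b2 = 0) \<or>
      (a1 \<noteq> 1/2 \<and> a1 \<noteq> 1 \<and> b2 = 1 - a1 \<and> b1^2 + (a1 - 1) * (2 * a1 - 1)^2 = 0)"
    | "a1 = 1/2" "b2 = 1/2" "b1 = 0"
    using half_eq_CHAR_3[OF c] by (metis diff_self)
  then show ?thesis
  proof cases
    case 1
    then have "F \<in> no_ideal_list3" unfolding A2_3 no_ideal_list3_def by blast
    then show ?thesis using has_ideals_A2_3_0[OF c 1] A2_3 by simp
  next
    case 2
    then have "F \<notin> no_ideal_list3" unfolding A2_3 no_ideal_list3_def by auto
    then show ?thesis using has_ideals_0_iff[OF has_ideals_A2_3_1[OF c 2]] A2_3 by simp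
  next
    case 3
    have "b2 = 1 - a1" by (simp only: 3 half_eq_CHAR_3[OF c])
    moreover have "a1 \<noteq> 1" unfolding 3(1) by (rule half_neq_1_CHAR_3[OF c])
    ultimately have "F \<notin> no_ideal_list3"
      unfolding A2_3 no_ideal_list3_def using 3(1,3) by blast
    then show ?thesis using has_ideals_0_iff[OF has_ideals_A2_3_2[OF c 3 i]] A2_3 by simp
  qed
next
  case (A3_3 b1 b2)
  then show ?thesis
    using has_ideals_0_iff[OF has_ideals_A3_3[OF c, of b1 b2]] by (auto simp: no_ideal_list3_def)
next
  case (A4_3 a1 b2)
  then show ?thesis
    using has_ideals_0_iff[OF has_ideals_A4[of a1 b2]] by (auto simp: no_ideal_list3_def)
next
  case (A5_3 a1)
  then show ?thesis
    using has_ideals_0_iff[OF has_ideals_A5_3[OF c, of a1]] by (auto simp: no_ideal_list3_def)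
next
  case (A6_3 a1 b1)
  then show ?thesis using has_ideals_A6 by (simp add: no_ideal_list3_def)
next
  case (A7_3 b1)
  then show ?thesis using has_ideals_A7_3[of b1] by (simp add: no_ideal_list3_def)
next
  case (A8_3 a1)
  then show ?thesis
    using has_ideals_0_iff[OF has_ideals_A8[of a1]] by (auto simp: no_ideal_list3_def)
next
  case A9_3
  then show ?thesis using has_ideals_A9_3[OF c] by (simp add: no_ideal_list3_def)
next
  case A10_3
  then show ?thesis
    using has_ideals_0_iff[OF has_ideals_A10[where 'a='a]] by (auto simp: no_ideal_list3_def)
next
  case A11_3
  then show ?thesis
    using has_ideals_0_iff[OF has_ideals_A11_3[where 'a='a]] by (auto simp: no_ideal_list3_def)
next
  case A12_3
  then show ?thesis
    using has_ideals_0_iff[OF has_ideals_A12[where 'a='a]] by (auto simp: no_ideal_list3_def)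
qed

text \<open>A shear by \<open>a1\<close> changes \<open>a1\<close> into \<open>3 * a1 = 0\<close>.
  This uses up the freedom of shearing, so \<open>d1\<close> survives as a parameter.\<close>

lemma dependent_msc_shear_3:
  fixes a1 :: "'a::field"
  assumes c: "CHAR('a) = 3"
  obtains d1 where "msc_isomorphic (dependent_msc \<rho> \<mu> a1 1 0 b1) (dependent_msc \<rho> \<mu> 0 1 0 d1)"
proof -
  define d1 where "d1 = b1 + a1 * (\<rho> + \<mu> - 2 * a1) - a1^2 * 1 - a1 * 0"
  have "a1 + 2 * a1 * 1 + a1^2 * 0 = 3 * a1" by simp
  then have "0 = a1 + 2 * a1 * 1 + a1^2 * 0" by (simp only: CHAR_3_simps(1)[OF c] mult_zero_left)
  moreover have "1 * d1 = b1 + a1 * (\<rho> + \<mu> - 2 * a1) - a1^2 * 1 - a1 * 0" by (simp add: d1_def)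
  ultimately show thesis using dependent_msc_shear[of 1 0 a1 a1 1 0 d1 b1 \<rho> \<mu>] that by simp
qed

lemma simple_msc3_exists:
  fixes A :: "'a::field^4^2"
  assumes roots: "\<And>p :: 'a poly. degree p = 2 \<or> degree p = 3 \<Longrightarrow> \<exists>x. poly p x = 0"
    and c: "CHAR('a) = 3" and simple: "has_ideals A 0"
  shows "\<exists>F. msc_isomorphic A (msc3 F)"
proof (cases A rule: trace_normal_form_cases)
  case (independent c1 c2 c4 d1)
  then have "msc_isomorphic A (msc3 (A1_3 c1 c2 c4 d1))" by simp
  then show ?thesis by blast
next
  case (right \<mu> c1 c2 c4 d1)
  show ?thesis
  proof (rule simple_dependent_msc_cases[OF roots has_ideals_0_isomorphic[OF right simple]])
    fix c1' d1'
    assume "msc_isomorphic (dependent_msc 1 \<mu> c1 c2 c4 d1) (dependent_msc 1 \<mu> c1' 0 1 d1')"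
    then have "msc_isomorphic A (msc3 (A2_3 c1' d1' (\<mu> - c1')))"
      using algebra_isomorphic_trans[OF right] by (simp only: msc3_dependent add_diff_cancel_left' diff_add_cancel add_diff_eq)
    then show ?thesis by blast
  next
    fix d1'
    assume 1: "msc_isomorphic (dependent_msc 1 \<mu> c1 c2 c4 d1) (dependent_msc 1 \<mu> c1 1 0 d1')"
    obtain e where "msc_isomorphic (dependent_msc 1 \<mu> c1 1 0 d1') (dependent_msc 1 \<mu> 0 1 0 e)"
      by (rule dependent_msc_shear_3[OF c])
    then have "msc_isomorphic A (msc3 (A3_3 e \<mu>))"
      using algebra_isomorphic_trans[OF algebra_isomorphic_trans[OF right 1]]
      by (simp only: msc3_dependent)
    then show ?thesis by blast
  qed
next
  case (left c1 c2 c4 d1)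
  show ?thesis
  proof (rule simple_dependent_msc_cases[OF roots has_ideals_0_isomorphic[OF left simple]])
    fix c1' d1'
    assume "msc_isomorphic (dependent_msc 0 1 c1 c2 c4 d1) (dependent_msc 0 1 c1' 0 1 d1')"
    then have "msc_isomorphic A (msc3 (A6_3 c1' d1'))"
      using algebra_isomorphic_trans[OF left] by (simp only: msc3_dependent)
    then show ?thesis by blast
  next
    fix d1'
    assume 1: "msc_isomorphic (dependent_msc 0 1 c1 c2 c4 d1) (dependent_msc 0 1 c1 1 0 d1')"
    obtain e where "msc_isomorphic (dependent_msc 0 1 c1 1 0 d1') (dependent_msc 0 1 0 1 0 e)"
      by (rule dependent_msc_shear_3[OF c])
    then have "msc_isomorphic A (msc3 (A7_3 e))"
      using algebra_isomorphic_trans[OF algebra_isomorphic_trans[OF left 1]]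
      by (simp only: msc3_dependent)
    then show ?thesis by blast
  qed
next
  case (zero c1 c2 c4 d1)
  obtain a1 a2 b1 where 1: "msc_isomorphic A (dependent_msc 0 0 a1 a2 0 b1)"
    unfolding zero by (rule dependent_msc_0_0_root[OF roots])
  show ?thesis
  proof (rule simple_dependent_msc_cases[OF roots has_ideals_0_isomorphic[OF 1 simple]])
    fix d1'
    assume 2: "msc_isomorphic (dependent_msc 0 0 a1 a2 0 b1) (dependent_msc 0 0 a1 1 0 d1')"
    obtain e where "msc_isomorphic (dependent_msc 0 0 a1 1 0 d1') (dependent_msc 0 0 0 1 0 e)"
      by (rule dependent_msc_shear_3[OF c])
    then have 3: "msc_isomorphic A (dependent_msc 0 0 0 1 0 e)"
      using algebra_isomorphic_trans[OF algebra_isomorphic_trans[OF 1 2]] by blast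
    \<comment> \<open>For \<open>e = 0\<close> the algebra would be \<open>A10_3\<close>, which has
      an ideal; a nonzero \<open>e\<close> is scaled to \<open>1\<close> by a square root of
      \<open>1 / e\<close>.\<close>
    have "e \<noteq> 0"
    proof
      assume "e = 0"
      then have "dependent_msc 0 0 0 1 0 e = msc3 A10_3" by (simp add: dependent_msc_def)
      then show False
        using has_ideals_0_isomorphic[OF 3 simple] has_ideals_0_iff[OF has_ideals_A10[where 'a='a]] by simp
    qed
    obtain k where k: "k^2 = 1 / e" using sqrt_exists[OF roots] by blast
    then have "k \<noteq> 0" "k^2 * e = 1" using \<open>e \<noteq> 0\<close> by auto
    then have "msc_isomorphic (dependent_msc 0 0 0 1 0 e) (msc3 A9_3)"
      using dependent_msc_0_0_scale[of k 0 1 e] by (simp add: msc3_dependent del: msc3.simps)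
    then show ?thesis using algebra_isomorphic_trans[OF 3] by blast
  qed simp_all
qed

text \<open>The merging is the same as in characteristic 2, except that for \<open>a4 = 0\<close>
  the normalized entry is \<open>a1\<close> instead of \<open>b1\<close>.\<close>

lemma no_ideal_list3_cases:
  assumes F: "(F :: 'a::field family3) \<in> no_ideal_list3"
  obtains (independent) a1 a2 a4 b1 where "F = A1_3 a1 a2 a4 b1"
    "msc3 F = msc [a1, a2, a2 + 1, a4] [b1, - a1, - a1 + 1, - a2]"
  | (dependent) \<rho> \<mu> a1 a2 a4 b1 where "msc3 F = dependent_msc \<rho> \<mu> a1 a2 a4 b1" "normalized_trace \<rho> \<mu>"
      "(a2, a4) \<in> {(0, 1), (1, 0)}" "a4 = 0 \<longrightarrow> a1 = 0"
      "F = (if \<rho> = 1 then if a4 = 1 then A2_3 a1 b1 (\<mu> - a1) else A3_3 b1 \<mu>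
            else if a4 = 1 then A6_3 a1 b1 else A7_3 b1)"
  | (zero) "F = A9_3" "msc3 F = dependent_msc 0 0 0 1 0 1"
proof (cases F)
  case (A1_3 a1 a2 a4 b1)
  then show thesis by (intro independent) simp_all
next
  case (A2_3 a1 b1 b2)
  then show thesis
    by (intro dependent[of 1 "a1 + b2" a1 0 1 b1]) (simp_all add: msc3_dependent normalized_trace_def del: msc3.simps)
next
  case (A3_3 b1 b2)
  then show thesis
    by (intro dependent[of 1 b2 0 1 0 b1]) (simp_all add: msc3_dependent normalized_trace_def del: msc3.simps)
next
  case (A6_3 a1 b1)
  then show thesis
    by (intro dependent[of 0 1 a1 0 1 b1]) (simp_all add: msc3_dependent normalized_trace_def del: msc3.simps)
next
  case (A7_3 b1)
  then show thesis
    by (intro dependent[of 0 1 0 1 0 b1]) (simp_all add: msc3_dependent normalized_trace_def del: msc3.simps)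
next
  case A9_3
  then show thesis by (intro zero) (simp_all add: msc3_dependent del: msc3.simps)
qed (use F in \<open>auto simp: no_ideal_list3_def\<close>)

lemma same_class3_refl: "same_class3 F F"
  by (cases F) simp_all

lemma no_ideal_list3_unique:
  assumes c: "CHAR('a::field) = 3"
    and F: "(F :: 'a family3) \<in> no_ideal_list3" and G: "G \<in> no_ideal_list3"
    and iso: "msc_isomorphic (msc3 F) (msc3 G)"
  shows "same_class3 F G"
  using F
proof (cases rule: no_ideal_list3_cases)
  case Fi: (independent a1 a2 a4 b1)
  from G show ?thesis
  proof (cases rule: no_ideal_list3_cases)
    case (independent c1 c2 c4 d1)
    then have "F = G"
      using independent_isomorphic_unique[of a1 a2 a4 b1 c1 c2 c4 d1] iso Fi by metis
    then show ?thesis by (simp add: same_class3_refl)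
  qed (use iso Fi independent_not_isomorphic_dependent in metis)+
next
  case Fd: (dependent \<rho> \<mu> a1 a2 a4 b1)
  from G show ?thesis
  proof (cases rule: no_ideal_list3_cases)
    case (independent c1 c2 c4 d1)
    then show ?thesis
      using algebra_isomorphic_sym[OF iso] Fd(1) independent_not_isomorphic_dependent by metis
  next
    case Gd: (dependent \<rho>' \<mu>' c1 c2 c4 d1)
    have u: "\<rho> = \<rho>' \<and> \<mu> = \<mu>' \<and> a2 = c2 \<and> a4 = c4 \<and> (a4 = 1 \<longrightarrow> a1 = c1 \<and> (d1 = b1 \<or> d1 = - b1)) \<and>
      (a4 = 0 \<longrightarrow> (\<exists>q. a1 = c1 + 2 * q \<and> a1 * q + b1 = d1 + q * (\<rho> + \<mu> - 2 * c1) - q^2))"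
      using iso Fd(1-3) Gd(1-3) by (intro dependent_isomorphic_unique) metis+
    from Fd(3) consider "a4 = 1" | "a4 = 0" by auto
    then show ?thesis
    proof cases
      case 1
      \<comment> \<open>The possible change of sign in \<open>b1\<close> is what
        \<open>same_class3\<close> identifies.\<close>
      then show ?thesis unfolding Fd(5) Gd(5) using u by (auto split: if_split)
    next
      case 2
      then obtain q where q: "a1 = c1 + 2 * q" "a1 * q + b1 = d1 + q * (\<rho> + \<mu> - 2 * c1) - q^2"
        using u by blast
      have "a1 = 0" "c1 = 0" using 2 u Fd(4) Gd(4) by simp_all
      \<comment> \<open>Both first entries vanish, so \<open>2 * q = 0\<close> leaves only the
        trivial shear.\<close>
      then have "q = 0" using q(1) CHAR_3_simps(3)[OF c] by simp
      then have "b1 = d1" using q(2) by simp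
      then show ?thesis unfolding Fd(5) Gd(5) using u 2 by (auto split: if_split)
    qed
  next
    case zero
    then show ?thesis
      using dependent_isomorphic_0_0 iso Fd(1,2) not_normalized_trace_0_0 by metis
  qed
next
  case Fz: zero
  from G show ?thesis
  proof (cases rule: no_ideal_list3_cases)
    case (independent c1 c2 c4 d1)
    then show ?thesis
      using algebra_isomorphic_sym[OF iso] Fz(2) independent_not_isomorphic_dependent by metis
  next
    case (dependent \<rho>' \<mu>' c1 c2 c4 d1)
    then show ?thesis
      using dependent_isomorphic_0_0 algebra_isomorphic_sym[OF iso] Fz(2) not_normalized_trace_0_0 by metis
  next
    case zero
    with Fz show ?thesis by simp
  qed
qed

text \<open>Negating the second basis vector preserves its square and changes the sign of
  \<open>b1\<close>.\<close>

lemma dependent_msc_reflect: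
  "msc_isomorphic (dependent_msc \<rho> \<mu> a1 0 1 b1) (dependent_msc \<rho> \<mu> a1 0 1 (- b1 :: 'a::field))"
  using dependent_msc_shear[of "-1" a1 a1 0 0 1 "- b1" b1 \<rho> \<mu>] by simp

lemma same_class3_isomorphic:
  assumes "same_class3 F G"
  shows "msc_isomorphic (msc3 F) (msc3 (G :: 'a::field family3))"
proof -
  consider "F = G" | a1 b1 b2 where "F = A2_3 a1 b1 b2" "G = A2_3 a1 (- b1) b2"
    | a1 b1 where "F = A6_3 a1 b1" "G = A6_3 a1 (- b1)"
    using assms by (cases "(F, G)" rule: same_class3.cases) auto
  then show ?thesis
  proof cases
    case 1
    then show ?thesis using algebra_isomorphic_refl by metis
  qed (simp_all only: msc3_dependent dependent_msc_reflect)
qed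

section \<open>Existence for abstract simple algebras, and assembly\<close>

lemma simple_algebra_exists_2:
  fixes scl :: "'a::field \<Rightarrow> 'v::ab_group_add \<Rightarrow> 'v"
  assumes roots: "\<And>p :: 'a poly. degree p = 2 \<or> degree p = 3 \<Longrightarrow> \<exists>x. poly p x = 0"
    and c: "CHAR('a) = 2" and simple: "simple_two_dim_algebra scl mul"
  shows "\<exists>F \<in> no_ideal_list2. algebra_isomorphic scl mul (*s) (msc_mult (msc2 F))"
proof -
  obtain A :: "'a^4^2" where A: "algebra_isomorphic scl mul (*s) (msc_mult A)" "has_ideals A 0"
    using simple_algebra_isomorphic_msc[OF simple] by blast
  then obtain F where F: "msc_isomorphic A (msc2 F)" using simple_msc2_exists[OF roots c] by blast
  then have "F \<in> no_ideal_list2"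
    using has_ideals_0_isomorphic A(2) no_ideal_list2_iff[OF c] by blast
  then show ?thesis using algebra_isomorphic_trans[OF A(1) F] by blast
qed

lemma simple_algebra_exists_3:
  fixes scl :: "'a::field \<Rightarrow> 'v::ab_group_add \<Rightarrow> 'v"
  assumes roots: "\<And>p :: 'a poly. degree p = 2 \<or> degree p = 3 \<Longrightarrow> \<exists>x. poly p x = 0"
    and c: "CHAR('a) = 3" and simple: "simple_two_dim_algebra scl mul"
  shows "\<exists>F \<in> no_ideal_list3. algebra_isomorphic scl mul (*s) (msc_mult (msc3 F))"
proof -
  obtain i :: 'a where i: "i^2 = -1" using sqrt_exists[OF roots] by blast
  obtain A :: "'a^4^2" where A: "algebra_isomorphic scl mul (*s) (msc_mult A)" "has_ideals A 0"
    using simple_algebra_isomorphic_msc[OF simple] by blast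
  then obtain F where F: "msc_isomorphic A (msc3 F)" using simple_msc3_exists[OF roots c] by blast
  then have "F \<in> no_ideal_list3"
    using has_ideals_0_isomorphic A(2) no_ideal_list3_iff[OF c i] by blast
  then show ?thesis using algebra_isomorphic_trans[OF A(1) F] by blast
qed

theorem mainTheorem6:
  fixes scl :: "'a::field \<Rightarrow> 'v::ab_group_add \<Rightarrow> 'v"
    and mul :: "'v \<Rightarrow> 'v \<Rightarrow> 'v"
  assumes roots: "\<And>p :: 'a poly. degree p = 2 \<or> degree p = 3 \<Longrightarrow> \<exists>x. poly p x = 0"
  shows
    "(CHAR('a) = 2 \<longrightarrow>
       (\<forall>\<alpha>\<^sub>1 \<alpha>\<^sub>2 \<alpha>\<^sub>4 \<beta>\<^sub>1 :: 'a.
          (\<alpha>\<^sub>4 \<noteq> \<alpha>\<^sub>1 \<or> \<beta>\<^sub>1 \<noteq> \<alpha>\<^sub>2 \<longrightarrow> has_ideals (msc2 (A1_2 \<alpha>\<^sub>1 \<alpha>\<^sub>2 \<alpha>\<^sub>4 \<beta>\<^sub>1)) 0) \<and>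
          (\<alpha>\<^sub>4 = \<alpha>\<^sub>1 \<and> \<beta>\<^sub>1 = \<alpha>\<^sub>2 \<longrightarrow> has_ideals (msc2 (A1_2 \<alpha>\<^sub>1 \<alpha>\<^sub>2 \<alpha>\<^sub>4 \<beta>\<^sub>1)) 1)) \<and>
       (\<forall>\<alpha>\<^sub>1 \<beta>\<^sub>1 \<beta>\<^sub>2 :: 'a.
          ((\<beta>\<^sub>2 = 1 - \<alpha>\<^sub>1 \<and> 1 - \<alpha>\<^sub>1 + \<beta>\<^sub>1^2 \<noteq> 0) \<or> \<beta>\<^sub>2 \<noteq> 1 - \<alpha>\<^sub>1
             \<longrightarrow> has_ideals (msc2 (A2_2 \<alpha>\<^sub>1 \<beta>\<^sub>1 \<beta>\<^sub>2)) 0) \<and>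
          (\<beta>\<^sub>2 = 1 - \<alpha>\<^sub>1 \<and> 1 - \<alpha>\<^sub>1 + \<beta>\<^sub>1^2 = 0 \<longrightarrow> has_ideals (msc2 (A2_2 \<alpha>\<^sub>1 \<beta>\<^sub>1 \<beta>\<^sub>2)) 1)) \<and>
       (\<forall>\<alpha>\<^sub>1 \<beta>\<^sub>2 :: 'a.
          (\<alpha>\<^sub>1 \<noteq> 1 \<or> \<beta>\<^sub>2 \<noteq> 0 \<longrightarrow> has_ideals (msc2 (A3_2 \<alpha>\<^sub>1 \<beta>\<^sub>2)) 0) \<and>
          (\<alpha>\<^sub>1 = 1 \<and> \<beta>\<^sub>2 = 0 \<longrightarrow> has_ideals (msc2 (A3_2 \<alpha>\<^sub>1 \<beta>\<^sub>2)) 2)) \<and>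
       (\<forall>\<alpha>\<^sub>1 \<beta>\<^sub>2 :: 'a.
          ((\<alpha>\<^sub>1 \<noteq> 1 \<and> \<beta>\<^sub>2 = 1 - \<alpha>\<^sub>1) \<or> \<beta>\<^sub>2 \<noteq> 1 - \<alpha>\<^sub>1
             \<longrightarrow> has_ideals (msc2 (A4_2 \<alpha>\<^sub>1 \<beta>\<^sub>2)) 1) \<and>
          (\<alpha>\<^sub>1 = 1 \<and> \<beta>\<^sub>2 = 0 \<longrightarrow> has_ideals (msc2 (A4_2 \<alpha>\<^sub>1 \<beta>\<^sub>2)) 2)) \<and>
       (\<forall>\<alpha>\<^sub>1 :: 'a. has_ideals (msc2 (A5_2 \<alpha>\<^sub>1)) 1) \<and>
       (\<forall>\<alpha>\<^sub>1 :: 'a. has_ideals (msc2 (A8_2 \<alpha>\<^sub>1)) 1) \<and>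
       has_ideals (msc2 (A9_2 :: 'a family2)) 1 \<and>
       has_ideals (msc2 (A10_2 :: 'a family2)) 1 \<and>
       has_ideals (msc2 (A12_2 :: 'a family2)) 1 \<and>
       (\<forall>\<alpha>\<^sub>1 \<beta>\<^sub>1 :: 'a. has_ideals (msc2 (A6_2 \<alpha>\<^sub>1 \<beta>\<^sub>1)) 0) \<and>
       (\<forall>\<alpha>\<^sub>1 :: 'a. has_ideals (msc2 (A7_2 \<alpha>\<^sub>1)) 0) \<and>
       has_ideals (msc2 (A11_2 :: 'a family2)) 0 \<and>
       (\<forall>F \<in> no_ideal_list2 :: 'a family2 set. msc_simple (msc2 F)) \<and>
       (simple_two_dim_algebra scl mul \<longrightarrow>
          (\<exists>F \<in> no_ideal_list2. algebra_isomorphic scl mul (*s) (msc_mult (msc2 F)))) \<and>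
       (\<forall>F \<in> no_ideal_list2 :: 'a family2 set. \<forall>G \<in> no_ideal_list2.
          msc_isomorphic (msc2 F) (msc2 G) \<longleftrightarrow> F = G))
     \<and>
     (CHAR('a) = 3 \<longrightarrow>
       (\<forall>\<alpha>\<^sub>1 \<alpha>\<^sub>2 \<alpha>\<^sub>4 \<beta>\<^sub>1 :: 'a.
          (\<alpha>\<^sub>4 \<noteq> - \<alpha>\<^sub>1 - 2 * \<alpha>\<^sub>2 \<or> \<beta>\<^sub>1 \<noteq> 2 * \<alpha>\<^sub>1 + \<alpha>\<^sub>2
             \<longrightarrow> has_ideals (msc3 (A1_3 \<alpha>\<^sub>1 \<alpha>\<^sub>2 \<alpha>\<^sub>4 \<beta>\<^sub>1)) 0) \<and>
          (\<alpha>\<^sub>4 = - \<alpha>\<^sub>1 - 2 * \<alpha>\<^sub>2 \<and> \<beta>\<^sub>1 = 2 * \<alpha>\<^sub>1 + \<alpha>\<^sub>2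
             \<longrightarrow> has_ideals (msc3 (A1_3 \<alpha>\<^sub>1 \<alpha>\<^sub>2 \<alpha>\<^sub>4 \<beta>\<^sub>1)) 1)) \<and>
       (\<forall>\<alpha>\<^sub>1 \<beta>\<^sub>1 \<beta>\<^sub>2 :: 'a.
          ((\<alpha>\<^sub>1 = 1 \<and> \<beta>\<^sub>1 \<noteq> 0 \<and> \<beta>\<^sub>2 = 0) \<or>
           (\<alpha>\<^sub>1 \<noteq> 1/2 \<and> \<alpha>\<^sub>1 \<noteq> 1 \<and> \<beta>\<^sub>1^2 + (\<alpha>\<^sub>1 - 1) * (2 * \<alpha>\<^sub>1 - 1)^2 \<noteq> 0 \<and> \<beta>\<^sub>2 = 1 - \<alpha>\<^sub>1) \<or>
           (\<alpha>\<^sub>1 = 1/2 \<and> \<beta>\<^sub>2 = 1/2 \<and> \<beta>\<^sub>1 \<noteq> 0) \<or>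
           \<beta>\<^sub>2 \<noteq> 1 - \<alpha>\<^sub>1
             \<longrightarrow> has_ideals (msc3 (A2_3 \<alpha>\<^sub>1 \<beta>\<^sub>1 \<beta>\<^sub>2)) 0) \<and>
          ((\<alpha>\<^sub>1 = 1 \<and> \<beta>\<^sub>1 = 0 \<and> \<beta>\<^sub>2 = 0) \<or>
           (\<alpha>\<^sub>1 \<noteq> 1/2 \<and> \<alpha>\<^sub>1 \<noteq> 1 \<and> \<beta>\<^sub>2 = 1 - \<alpha>\<^sub>1 \<and> \<beta>\<^sub>1^2 + (\<alpha>\<^sub>1 - 1) * (2 * \<alpha>\<^sub>1 - 1)^2 = 0)
             \<longrightarrow> has_ideals (msc3 (A2_3 \<alpha>\<^sub>1 \<beta>\<^sub>1 \<beta>\<^sub>2)) 1) \<and>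
          (\<alpha>\<^sub>1 = 1/2 \<and> \<beta>\<^sub>2 = 1/2 \<and> \<beta>\<^sub>1 = 0
             \<longrightarrow> has_ideals (msc3 (A2_3 \<alpha>\<^sub>1 \<beta>\<^sub>1 \<beta>\<^sub>2)) 2)) \<and>
       (\<forall>\<beta>\<^sub>1 \<beta>\<^sub>2 :: 'a.
          ((\<beta>\<^sub>1 \<noteq> -1 \<and> \<beta>\<^sub>2 = 1) \<or> \<beta>\<^sub>2 \<noteq> 1 \<longrightarrow> has_ideals (msc3 (A3_3 \<beta>\<^sub>1 \<beta>\<^sub>2)) 0) \<and>
          (\<beta>\<^sub>1 = -1 \<and> \<beta>\<^sub>2 = 1 \<longrightarrow> has_ideals (msc3 (A3_3 \<beta>\<^sub>1 \<beta>\<^sub>2)) 1)) \<and>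
       (\<forall>\<alpha>\<^sub>1 \<beta>\<^sub>2 :: 'a.
          ((\<alpha>\<^sub>1 \<noteq> 1 \<and> \<beta>\<^sub>2 = 1 - \<alpha>\<^sub>1) \<or> \<beta>\<^sub>2 \<noteq> 1 - \<alpha>\<^sub>1
             \<longrightarrow> has_ideals (msc3 (A4_3 \<alpha>\<^sub>1 \<beta>\<^sub>2)) 1) \<and>
          (\<alpha>\<^sub>1 = 1 \<and> \<beta>\<^sub>2 = 0 \<longrightarrow> has_ideals (msc3 (A4_3 \<alpha>\<^sub>1 \<beta>\<^sub>2)) 2)) \<and>
       (\<forall>\<alpha>\<^sub>1 :: 'a. has_ideals (msc3 (A5_3 \<alpha>\<^sub>1)) 1) \<and>
       (\<forall>\<alpha>\<^sub>1 :: 'a. has_ideals (msc3 (A8_3 \<alpha>\<^sub>1)) 1) \<and>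
       has_ideals (msc3 (A10_3 :: 'a family3)) 1 \<and>
       has_ideals (msc3 (A11_3 :: 'a family3)) 1 \<and>
       has_ideals (msc3 (A12_3 :: 'a family3)) 1 \<and>
       (\<forall>\<alpha>\<^sub>1 \<beta>\<^sub>1 :: 'a. has_ideals (msc3 (A6_3 \<alpha>\<^sub>1 \<beta>\<^sub>1)) 0) \<and>
       (\<forall>\<beta>\<^sub>1 :: 'a. has_ideals (msc3 (A7_3 \<beta>\<^sub>1)) 0) \<and>
       has_ideals (msc3 (A9_3 :: 'a family3)) 0 \<and>
       (\<forall>F \<in> no_ideal_list3 :: 'a family3 set. msc_simple (msc3 F)) \<and>
       (simple_two_dim_algebra scl mul \<longrightarrow>
          (\<exists>F \<in> no_ideal_list3. algebra_isomorphic scl mul (*s) (msc_mult (msc3 F)))) \<and>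
       (\<forall>F \<in> no_ideal_list3 :: 'a family3 set. \<forall>G \<in> no_ideal_list3.
          msc_isomorphic (msc3 F) (msc3 G) \<longleftrightarrow> same_class3 F G))"
proof -
  obtain i :: 'a where i: "i^2 = -1" using sqrt_exists[OF roots] by blast
  show ?thesis
  \<comment> \<open>Goals 1 to 19 concern characteristic 2 and goals 20 to 39 characteristic 3; in
    each group the ideal counts come first, then simplicity, existence and uniqueness.\<close>
  proof (intro conjI impI allI ballI, goal_cases)
  case (1 a1 a2 a4 b1)
  then show ?case
    using has_ideals_A1_2[OF 1(1), of a1 a2 a4 b1] by (auto simp del: msc2.simps msc3.simps split: if_splits)
next
  case (2 a1 a2 a4 b1)
  then show ?case
    using has_ideals_A1_2[OF 2(1), of a1 a2 a4 b1] by (auto simp del: msc2.simps msc3.simps split: if_splits)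
next
  case (3 a1 b1 b2)
  then show ?case
    using has_ideals_A2_2[OF 3(1), of a1 b1 b2] by (auto simp del: msc2.simps msc3.simps split: if_splits)
next
  case (4 a1 b1 b2)
  then show ?case
    using has_ideals_A2_2[OF 4(1), of a1 b1 b2] by (auto simp del: msc2.simps msc3.simps split: if_splits)
next
  case (5 a1 b2)
  then show ?case
    using has_ideals_A3_2[OF 5(1), of a1 b2] by (auto simp del: msc2.simps msc3.simps split: if_splits)
next
  case (6 a1 b2)
  then show ?case
    using has_ideals_A3_2[OF 6(1), of a1 b2] by (auto simp del: msc2.simps msc3.simps split: if_splits)
next
  case (7 a1 b2)
  then show ?case
    using has_ideals_A4[of a1 b2] by (auto split: if_splits)
next
  case (8 a1 b2)
  then show ?case
    using has_ideals_A4[of a1 b2] by (auto split: if_splits)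
next
  case (9 a1)
  then show ?case
    by (intro has_ideals_A5_2)
next
  case (10 a1)
  then show ?case
    by (simp only: msc2.simps has_ideals_A8)
next
  case 11
  then show ?case
    by (intro has_ideals_A9_2)
next
  case 12
  then show ?case
    by (simp only: msc2.simps has_ideals_A10)
next
  case 13
  then show ?case
    by (simp only: msc2.simps has_ideals_A12)
next
  case (14 a1 b1)
  then show ?case
    by (simp only: msc2.simps has_ideals_A6)
next
  case (15 a1)
  then show ?case
    by (intro has_ideals_A7_2)
next
  case 16
  then show ?case
    by (intro has_ideals_A11_2)
next
  case (17 F)
  then show ?case
    by (simp only: no_ideal_list2_iff msc_simple_iff)
next
  case 18
  then show ?case
    by (intro simple_algebra_exists_2[OF roots])
next
  case (19 F G)
  then show ?case
    using no_ideal_list2_unique algebra_isomorphic_refl by metis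
next
  case (20 a1 a2 a4 b1)
  then show ?case
    by (simp only: msc3.simps has_ideals_A1_0)
next
  case (21 a1 a2 a4 b1)
  then show ?case
    unfolding msc3.simps by (intro has_ideals_A1_1) simp_all
next
  case (22 a1 b1 b2)
  then show ?case
    by (intro has_ideals_A2_3_0)
next
  case (23 a1 b1 b2)
  then show ?case
    by (intro has_ideals_A2_3_1)
next
  case (24 a1 b1 b2)
  then show ?case
    by (intro has_ideals_A2_3_2[OF _ _ _ _ i]) simp_all
next
  case (25 b1 b2)
  then show ?case
    using has_ideals_A3_3[OF 25(1), of b1 b2] by (auto simp del: msc2.simps msc3.simps split: if_splits)
next
  case (26 b1 b2)
  then show ?case
    using has_ideals_A3_3[OF 26(1), of b1 b2] by (auto simp del: msc2.simps msc3.simps split: if_splits)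
next
  case (27 a1 b2)
  then show ?case
    using has_ideals_A4[of a1 b2] by (auto split: if_splits)
next
  case (28 a1 b2)
  then show ?case
    using has_ideals_A4[of a1 b2] by (auto split: if_splits)
next
  case (29 a1)
  then show ?case
    by (intro has_ideals_A5_3)
next
  case (30 a1)
  then show ?case
    by (simp only: msc3.simps has_ideals_A8)
next
  case 31
  then show ?case
    by (simp only: msc3.simps has_ideals_A10)
next
  case 32
  then show ?case
    by (intro has_ideals_A11_3)
next
  case 33
  then show ?case
    by (simp only: msc3.simps has_ideals_A12)
next
  case (34 a1 b1)
  then show ?case
    by (simp only: msc3.simps has_ideals_A6)
next
  case (35 b1)
  then show ?case
    by (intro has_ideals_A7_3)
next
  case 36
  then show ?case
    by (intro has_ideals_A9_3)
next
  case (37 F)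
  then show ?case
    by (simp only: no_ideal_list3_iff[OF _ i] msc_simple_iff)
next
  case 38
  then show ?case
    by (intro simple_algebra_exists_3[OF roots])
next
  case (39 F G)
  then show ?case
    using no_ideal_list3_unique same_class3_isomorphic by blast
qed
qed

end
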